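(* Let $n\ge 1$, $0\le p\le n-1$ and $N\ge 1$ be integers and let $\mathcal I$ be a $\mathbb Z$-order in $Cl_n$ that is stable under the reversion and the main involution. Let $f:H^{+}(\mathbb R\oplus\mathbb R^n)\to Cl_n$ be a left monogenic automorphic form on $\Gamma_p(\mathcal I)[N]$ of weight $n$, i.e. $Df=0$ on $H^{+}(\mathbb R\oplus\mathbb R^n)$ and $$f(x)=\frac{\overline{cx+d}}{\|cx+d\|^{n+1}}\,f(M\langle x\rangle)\qquad\text{for all }x\in H^{+}(\mathbb R\oplus\mathbb R^n),\ M=\begin{pmatrix}a&b\\c&d\end{pmatrix}\in\Gamma_p(\mathcal I)[N].$$ Then $g(x):=x_n^{-(1-n)/2}f(x)$ is a quasi-$\Gamma_p(\mathcal I)[N]$-invariant ($Cl_n$-valued) Maass wave form for the eigenvalue $-\frac14(n^2-1)$ with automorphy factor $\frac{\overline{cx+d}}{\|cx+d\|^2}$; that is, $$\Delta_{LB}\,g=-\tfrac14(n^2-1)\,g\quad\text{on }H^{+}(\mathbb R\oplus\mathbb R^n)$$ and $$g(x)=\frac{\overline{cx+d}}{\|cx+d\|^2}\,g(M\langle x\rangle)\qquad\text{for all }x\in H^{+}(\mathbb R\oplus\mathbb R^n),\ M=\begin{pmatrix}a&b\\c&d\end{pmatrix}\in\Gamma_p(\mathcal I)[N].$$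
   Context: Clifford algebra: $Cl_n$ is the real Clifford algebra generated by the standard basis $e_1,\dots,e_n$ of $\mathbb R^n$ with $e_ie_j+e_je_i=-2\delta_{ij}$; it has the basis $e_A=e_{j_1}\cdots e_{j_r}$ for $A=\{j_1<\dots<j_r\}\subseteq\{1,\dots,n\}$, $e_\emptyset=e_0=1$. $\|\cdot\|$ is the Euclidean norm with respect to this basis. Conjugation is the anti-automorphism $\overline{ab}=\overline b\,\overline a$ with $\overline{e_j}=-e_j$; reversion is the anti-automorphism $\widetilde{ab}=\tilde b\tilde a$ with $\tilde e_j=e_j$; the main involution is the automorphism $(ab)'=a'b'$ with $e_j'=-e_j$. For $p\le n$, elements $x_0+x_1e_1+\dots+x_pe_p$ of $\mathbb R\oplus\mathbb R^p$ are called paravectors. Upper half-space: $H^{+}(\mathbb R\oplus\mathbb R^n)=\{x=x_0+x_1e_1+\dots+x_ne_n : x_n>0\}$. Operators: $D=\frac{\partial}{\partial x_0}+\sum_{i=1}^n e_i\frac{\partial}{\partial x_i}$ (acting from the left); a real differentiable $Cl_n$-valued function with $Df=0$ is called left monogenic. The Laplace–Beltrami operator is $\Delta_{LB}=x_n^2\sum_{i=0}^n\frac{\partial^2}{\partial x_i^2}-(n-1)x_n\frac{\partial}{\partial x_n}$, acting componentwise on $Cl_n$-valued functions. Groups: for $0\le p\le n-1$, $SAV(\mathbb R\oplus\mathbb R^p)$ is the group of matrices $M=\begin{pmatrix}a&b\\c&d\end{pmatrix}$ whose entries are products of paravectors from $\mathbb R\oplus\mathbb R^p$, with $a\tilde d-b\tilde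 c=1$, and $a^{-1}b\in\mathbb R\oplus\mathbb R^p$ if $a\ne0$, $c^{-1}d\in\mathbb R\oplus\mathbb R^p$ if $c\neq0$. It acts on $H^{+}(\mathbb R\oplus\mathbb R^n)$ by $M\langle x\rangle=(ax+b)(cx+d)^{-1}$. $SAV(\mathbb R\oplus\mathbb R^p,\mathbb Q)$ consists of those matrices satisfying: (i) $a\bar a,b\bar b,c\bar c,d\bar d\in\mathbb Q$; (ii) $a\bar c,b\bar d\in\mathbb Q\oplus\mathbb Q^n$; (iii) $ax\bar b+b\bar x\bar a,\ cx\bar d+d\bar x\bar c\in\mathbb Q$ for all $x\in\mathbb Q\oplus\mathbb Q^n$; (iv) $ax\bar d+b\bar x\bar c\in\mathbb Q\oplus\mathbb Q^n$ for all $x\in\mathbb Q\oplus\mathbb Q^n$. A $\mathbb Z$-order $\mathcal I$ in $Cl_n$ is a subring of the rational Clifford algebra $\bigoplus_A\mathbb Qe_A$ whose additive group is finitely generated and contains a $\mathbb Q$-basis of the rational Clifford algebra. $\Gamma_p(\mathcal I)=SAV(\mathbb R\oplus\mathbb R^p,\mathbb Q)\cap \mathrm{Mat}(2,\mathcal I)$, and $\Gamma_p(\mathcal I)[N]=\{M\in\Gamma_p(\mathcal I): a-1,b,c,d-1\in N\mathcal I\}$. *)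

theory Defs
  imports "HOL-Analysis.Analysis"
begin

section \<open>The real Clifford algebra\<close>

text \<open>
  The index type of class finite and linorder plays the role of $\{1 < \dots < n\}$, with
  $n$ its cardinality.  An element is given by its real coefficients with respect to the
  basis $e_A$, where $A$ ranges over the sets of indices.
\<close>

typedef 'n clifford = "UNIV :: ('n set \<Rightarrow> real) set"
  morphisms cl_coeff Cl by simp

lemma cl_coeff_Cl [simp]: "cl_coeff (Cl u) = u"
  by (simp add: Cl_inverse)

lemma clifford_eqI: "(\<And>A. cl_coeff x A = cl_coeff y A) \<Longrightarrow> x = y"
  by (metis cl_coeff_inverse ext)

lemma clifford_eq_iff: "x = y \<longleftrightarrow> (\<forall>A. cl_coeff x A = cl_coeff y A)"
  using clifford_eqI by auto

instantiation clifford :: (type) real_vector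
begin

definition "0 = Cl (\<lambda>A. 0)"
definition "x + y = Cl (\<lambda>A. cl_coeff x A + cl_coeff y A)"
definition "- x = Cl (\<lambda>A. - cl_coeff x A)"
definition "x - y = Cl (\<lambda>A. cl_coeff x A - cl_coeff y A)"
definition "r *\<^sub>R x = Cl (\<lambda>A. r * cl_coeff x A)"

instance
  by standard (auto simp: zero_clifford_def plus_clifford_def uminus_clifford_def
      minus_clifford_def scaleR_clifford_def clifford_eq_iff algebra_simps)

end

lemma cl_coeff_zero [simp]: "cl_coeff 0 A = 0"
  and cl_coeff_add [simp]: "cl_coeff (x + y) A = cl_coeff x A + cl_coeff y A"
  and cl_coeff_uminus [simp]: "cl_coeff (- x) A = - cl_coeff x A"
  and cl_coeff_diff [simp]: "cl_coeff (x - y) A = cl_coeff x A - cl_coeff y A"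
  and cl_coeff_scaleR [simp]: "cl_coeff (r *\<^sub>R x) A = r * cl_coeff x A"
  by (simp_all add: zero_clifford_def plus_clifford_def uminus_clifford_def
      minus_clifford_def scaleR_clifford_def)

lemma cl_coeff_sum [simp]: "cl_coeff (sum f S) A = (\<Sum>s\<in>S. cl_coeff (f s) A)"
  by (induction S rule: infinite_finite_induct) auto

definition cl_basis :: "'n set \<Rightarrow> 'n clifford" where
  "cl_basis A = Cl (\<lambda>B. if B = A then 1 else 0)"

lemma cl_coeff_basis [simp]: "cl_coeff (cl_basis A) B = (if B = A then 1 else 0)"
  by (simp add: cl_basis_def)

lemma clifford_expand:
  fixes x :: "'n::finite clifford"
  shows "x = (\<Sum>A\<in>UNIV. cl_coeff x A *\<^sub>R cl_basis A)"
  by (rule clifford_eqI) (simp add: if_distrib cong: if_cong)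

subsection \<open>Euclidean structure\<close>

instantiation clifford :: (finite) euclidean_space
begin

definition "inner x y = (\<Sum>A\<in>UNIV. cl_coeff x A * cl_coeff y A)"
definition norm_clifford :: "'a clifford \<Rightarrow> real"
  where "norm_clifford x = sqrt (\<Sum>A\<in>UNIV. (cl_coeff x A)\<^sup>2)"
definition "sgn x = x /\<^sub>R norm x" for x :: "'a clifford"
definition "dist x y = norm (x - y)" for x :: "'a clifford"
definition [code del]:
  "(uniformity :: ('a clifford \<times> 'a clifford) filter) = (INF e\<in>{0<..}. principal {(x, y). dist x y < e})"
definition [code del]:
  "open (U :: 'a clifford set) \<longleftrightarrow>
    (\<forall>x\<in>U. eventually (\<lambda>(x', y). x' = x \<longrightarrow> y \<in> U) uniformity)"
definition "Basis = range (cl_basis :: 'a set \<Rightarrow> 'a clifford)"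

instance
proof
  fix x y z :: "'a clifford" and r :: real and U :: "'a clifford set"
  show "dist x y = norm (x - y)" by (fact dist_clifford_def)
  show "sgn x = x /\<^sub>R norm x" by (fact sgn_clifford_def)
  show "(uniformity :: ('a clifford \<times> 'a clifford) filter) =
      (INF e\<in>{0<..}. principal {(x, y). dist x y < e})"
    by (fact uniformity_clifford_def)
  show "open U \<longleftrightarrow> (\<forall>x\<in>U. eventually (\<lambda>(x', y). x' = x \<longrightarrow> y \<in> U) uniformity)"
    by (fact open_clifford_def)
  show "inner x y = inner y x"
    by (simp add: inner_clifford_def mult.commute)
  show "inner (x + y) z = inner x z + inner y z"
    by (simp add: inner_clifford_def algebra_simps sum.distrib)
  show "inner (r *\<^sub>R x) y = r * inner x y"
    by (simp add: inner_clifford_def sum_distrib_left mult.assoc)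
  show "0 \<le> inner x x"
    by (simp add: inner_clifford_def sum_nonneg)
  show "(inner x x = 0) \<longleftrightarrow> x = 0"
    by (simp add: inner_clifford_def sum_nonneg_eq_0_iff clifford_eq_iff)
  show "norm x = sqrt (inner x x)"
    by (simp add: norm_clifford_def inner_clifford_def power2_eq_square)
  show "finite (Basis :: 'a clifford set)" "(Basis :: 'a clifford set) \<noteq> {}"
    by (simp_all add: Basis_clifford_def)
  show "(\<forall>u\<in>Basis. inner x u = 0) \<longleftrightarrow> x = 0"
    by (simp add: Basis_clifford_def inner_clifford_def clifford_eq_iff if_distrib cong: if_cong)
next
  fix u v :: "'a clifford"
  assume "u \<in> Basis" "v \<in> Basis"
  then obtain A B where "u = cl_basis A" "v = cl_basis B"
    by (auto simp: Basis_clifford_def)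
  moreover have "inner (cl_basis A) (cl_basis B :: 'a clifford) = (if A = B then 1 else 0)"
  proof -
    have "inner (cl_basis A) (cl_basis B :: 'a clifford)
        = (\<Sum>C\<in>UNIV. if C = A then (if A = B then 1 else 0) else 0)"
      unfolding inner_clifford_def by (intro sum.cong) auto
    then show ?thesis by simp
  qed
  moreover have "cl_basis A = (cl_basis B :: 'a clifford) \<longleftrightarrow> A = B"
    by (metis cl_coeff_basis zero_neq_one)
  ultimately show "inner u v = (if u = v then 1 else 0)"
    by simp
qed

end

subsection \<open>Multiplication\<close>

text \<open>
  Reordering $e_A e_B$ costs a factor $-1$ for every $(i,j) \in A \times B$ with $i > j$
  (anticommutation) and for every $i = j$ (as $e_i^2 = -1$); what remains is the basis
  element of the symmetric difference.
\<close>

definition cl_sign :: "'n::linorder set \<Rightarrow> 'n set \<Rightarrow> real" where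
  "cl_sign A B = (\<Prod>i\<in>A. \<Prod>j\<in>B. if j \<le> i then -1 else 1)"

lemma cl_sign_empty [simp]: "cl_sign {} A = 1" "cl_sign A {} = 1"
  by (simp_all add: cl_sign_def)

lemma prod_sym_diff:
  fixes h :: "'a::finite \<Rightarrow> real"
  assumes "\<And>i. h i * h i = 1"
  shows "prod h (sym_diff A B) = prod h A * prod h B"
proof -
  have 1: "prod h (A \<inter> B) * prod h (A \<inter> B) = 1"
    by (simp add: assms flip: prod.distrib)
  have "prod h A = prod h (A - B) * prod h (A \<inter> B)"
    using prod.union_disjoint[of "A - B" "A \<inter> B" h]
    by (metis Diff_disjoint Int_Diff Int_commute Un_Diff_Int finite inf_assoc inf_bot_right)
  moreover have "prod h B = prod h (B - A) * prod h (A \<inter> B)"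
    using prod.union_disjoint[of "B - A" "A \<inter> B" h]
    by (metis Diff_disjoint Int_Diff Int_commute Un_Diff_Int finite inf_assoc inf_bot_right)
  moreover have "prod h (sym_diff A B) = prod h (A - B) * prod h (B - A)"
    by (rule prod.union_disjoint) auto
  ultimately show ?thesis
    using 1 by (simp add: algebra_simps)
qed

lemma cl_sign_square: "cl_sign A B * cl_sign A B = 1"
  unfolding cl_sign_def prod.distrib[symmetric] by (intro prod.neutral ballI) auto

lemma cl_sign_sym_diff_left:
  fixes A B C :: "'n::{finite,linorder} set"
  shows "cl_sign (sym_diff A B) C = cl_sign A C * cl_sign B C"
  unfolding cl_sign_def
  by (rule prod_sym_diff) (unfold prod.distrib[symmetric], intro prod.neutral ballI, auto)

lemma cl_sign_sym_diff_right:
  fixes A B C :: "'n::{finite,linorder} set"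
  shows "cl_sign A (sym_diff B C) = cl_sign A B * cl_sign A C"
  unfolding cl_sign_def prod.distrib[symmetric]
  by (intro prod.cong refl prod_sym_diff) auto

instantiation clifford :: ("{finite,linorder}") ring_1
begin

definition "1 = cl_basis {}"

definition "x * y = (\<Sum>A\<in>UNIV. \<Sum>B\<in>UNIV.
    (cl_coeff x A * cl_coeff y B * cl_sign A B) *\<^sub>R cl_basis (sym_diff A B))"

lemma clifford_mult_sum_left: "sum f S * y = (\<Sum>s\<in>S. f s * y)" if "finite S"
  for y :: "'a clifford"
  using that
  by (induction S) (simp_all add: times_clifford_def algebra_simps sum.distrib scaleR_add_left)

lemma clifford_mult_sum_right: "y * sum f S = (\<Sum>s\<in>S. y * f s)" if "finite S"
  for y :: "'a clifford"
  using that
  by (induction S) (simp_all add: times_clifford_def algebra_simps sum.distrib scaleR_add_left)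

lemma clifford_mult_scaleR:
  "(r *\<^sub>R x) * y = r *\<^sub>R (x * y)" "x * (r *\<^sub>R y) = r *\<^sub>R (x * y)" for x y :: "'a clifford"
  by (simp_all add: times_clifford_def scaleR_sum_right mult_ac)

lemma basis_mult:
  "cl_basis A * cl_basis B = cl_sign A B *\<^sub>R (cl_basis (sym_diff A B) :: 'a clifford)"
proof -
  have "cl_basis A * cl_basis B = (\<Sum>A'\<in>UNIV. \<Sum>B'\<in>UNIV. if A' = A \<and> B' = B
      then cl_sign A B *\<^sub>R (cl_basis (sym_diff A B) :: 'a clifford) else 0)"
    unfolding times_clifford_def by (intro sum.cong refl) simp
  also have "\<dots> = (\<Sum>A'\<in>UNIV. if A' = A
      then cl_sign A B *\<^sub>R (cl_basis (sym_diff A B) :: 'a clifford) else 0)"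
    by (intro sum.cong refl) (simp add: sum.delta)
  finally show ?thesis by simp
qed

lemma basis_mult_assoc:
  "cl_basis A * cl_basis B * cl_basis C = cl_basis A * (cl_basis B * (cl_basis C :: 'a clifford))"
proof -
  have "sym_diff (sym_diff A B) C = sym_diff A (sym_diff B C)" by blast
  then show ?thesis
    by (simp add: basis_mult clifford_mult_scaleR cl_sign_sym_diff_left cl_sign_sym_diff_right
        mult_ac del: Un_Diff)
qed

instance
proof
  fix x y z :: "'a clifford"
  show "(x + y) * z = x * z + y * z" "x * (y + z) = x * y + x * z"
    by (simp_all add: times_clifford_def algebra_simps sum.distrib scaleR_add_left)
  show "(0 :: 'a clifford) \<noteq> 1"
    by (auto simp: one_clifford_def clifford_eq_iff)
  show "x * y * z = x * (y * z)"
  proof -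
    have "x * y * z = (\<Sum>A\<in>UNIV. cl_coeff x A *\<^sub>R cl_basis A) * (\<Sum>B\<in>UNIV. cl_coeff y B *\<^sub>R cl_basis B)
        * (\<Sum>C\<in>UNIV. cl_coeff z C *\<^sub>R cl_basis C)"
      by (simp flip: clifford_expand)
    also have "\<dots> = (\<Sum>A\<in>UNIV. cl_coeff x A *\<^sub>R cl_basis A) * ((\<Sum>B\<in>UNIV. cl_coeff y B *\<^sub>R cl_basis B)
        * (\<Sum>C\<in>UNIV. cl_coeff z C *\<^sub>R cl_basis C))"
      by (simp add: clifford_mult_sum_left clifford_mult_sum_right clifford_mult_scaleR
          basis_mult_assoc)
    finally show ?thesis by (simp flip: clifford_expand)
  qed
  show "1 * x = x"
    by (subst (1 2) clifford_expand[of x])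
      (simp add: one_clifford_def clifford_mult_sum_right clifford_mult_scaleR basis_mult)
  show "x * 1 = x"
    by (subst (1 2) clifford_expand[of x])
      (simp add: one_clifford_def clifford_mult_sum_left clifford_mult_scaleR basis_mult)
qed

end

instance clifford :: ("{finite,linorder}") real_algebra_1
  by standard (fact clifford_mult_scaleR)+

definition cl_gen :: "'n \<Rightarrow> 'n clifford" where
  "cl_gen i = cl_basis {i}"

lemma cl_gen_anticommute:
  fixes i j :: "'n::{finite,linorder}"
  shows "cl_gen i * cl_gen j + cl_gen j * cl_gen i = of_real (if i = j then -2 else 0)"
  by (cases i j rule: linorder_cases)
    (auto simp: cl_gen_def basis_mult cl_sign_def of_real_def one_clifford_def clifford_eq_iff)

lemma cl_basis_eq_prod:
  fixes A :: "'n::{finite,linorder} set"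
  shows "cl_basis A = prod_list (map cl_gen (sorted_list_of_set A))"
  using finite[of A]
proof (induction A rule: finite_linorder_min_induct)
  case empty
  show ?case by (simp add: one_clifford_def)
next
  case (insert b A)
  then have "b \<notin> A" by blast
  have "sorted_list_of_set (insert b A) = b # sorted_list_of_set A"
    using insert \<open>b \<notin> A\<close>
    by (subst sorted_list_of_set_insert) (auto intro!: insort_is_Cons less_imp_le)
  moreover have "cl_sign {b} A = 1"
    using insert by (auto simp: cl_sign_def not_le intro!: prod.neutral)
  moreover have "sym_diff {b} A = insert b A"
    using \<open>b \<notin> A\<close> by auto
  moreover have "cl_gen b * cl_basis A = cl_sign {b} A *\<^sub>R cl_basis (sym_diff {b} A)"
    by (simp only: cl_gen_def basis_mult)
  ultimately show ?case
    using insert.IH by (simp only: list.map prod_list.Cons scaleR_one)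
qed

subsection \<open>Inverse and involutions\<close>

instantiation clifford :: ("{finite,linorder}") inverse
begin

definition "inverse x = (if \<exists>y. x * y = 1 \<and> y * x = 1 then THE y. x * y = 1 \<and> y * x = 1 else 0)"
  for x :: "'a clifford"
definition "x div y = x * inverse y" for x y :: "'a clifford"

instance ..

end

definition conjugation :: "'n clifford \<Rightarrow> 'n clifford" where
  "conjugation x = Cl (\<lambda>A. (-1) ^ (card A * (card A + 1) div 2) * cl_coeff x A)"

definition reversion :: "'n clifford \<Rightarrow> 'n clifford" where
  "reversion x = Cl (\<lambda>A. (-1) ^ (card A * (card A - 1) div 2) * cl_coeff x A)"

definition main_involution :: "'n clifford \<Rightarrow> 'n clifford" where
  "main_involution x = Cl (\<lambda>A. (-1) ^ card A * cl_coeff x A)"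

lemma linear_involutions: "linear conjugation" "linear reversion" "linear main_involution"
  by (rule linearI; simp add: clifford_eq_iff conjugation_def reversion_def main_involution_def
      algebra_simps)+

lemma involutions_gen:
  "conjugation (cl_gen i) = - cl_gen i"
  "reversion (cl_gen i) = cl_gen i"
  "main_involution (cl_gen i) = - cl_gen i"
  by (auto simp: clifford_eq_iff conjugation_def reversion_def main_involution_def cl_gen_def)

lemma involutions_one:
  fixes x :: "'n::{finite,linorder} clifford"
  shows "conjugation (1 :: 'n clifford) = 1" "reversion (1 :: 'n clifford) = 1"
    "main_involution (1 :: 'n clifford) = 1"
  by (auto simp: clifford_eq_iff conjugation_def reversion_def main_involution_def
      one_clifford_def)

lemma conjugation_sign:
  fixes A :: "'n::{finite,linorder} set"
  shows "(-1) ^ (card A * (card A + 1) div 2) = cl_sign A A"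
  using finite[of A]
proof (induction A rule: finite_linorder_max_induct)
  case empty
  show ?case by simp
next
  case (insert b A)
  then have "b \<notin> A" by blast
  have 1: "(\<Prod>j\<in>A. if j \<le> b then -1 else 1 :: real) = (-1) ^ card A"
    using insert by (simp add: less_imp_le cong: prod.cong)
  have 2: "(\<Prod>i\<in>A. (if b \<le> i then -1 else 1) * (\<Prod>j\<in>A. if j \<le> i then -1 else 1 :: real))
      = cl_sign A A"
    unfolding cl_sign_def using insert by (intro prod.cong) auto
  have 3: "Suc (card A) * (Suc (card A) + 1) div 2 = card A * (card A + 1) div 2 + Suc (card A)"
  proof -
    have "Suc (card A) * (Suc (card A) + 1) = card A * (card A + 1) + 2 * Suc (card A)"
      by (simp add: algebra_simps)
    then show ?thesis by simp
  qed
  have "cl_sign (insert b A) (insert b A) = cl_sign A A * (-1) ^ Suc (card A)"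
    unfolding cl_sign_def[of "insert b A"] using \<open>b \<notin> A\<close> insert(1) by (simp add: 1 2)
  moreover have "card (insert b A) = Suc (card A)"
    using \<open>b \<notin> A\<close> by simp
  ultimately show ?case
    using insert.IH by (simp only: 3 power_add)
qed

lemma main_involution_sign:
  fixes A B :: "'n::finite set"
  shows "(-1 :: real) ^ card (sym_diff A B) = (-1) ^ card A * (-1) ^ card B"
  using prod_sym_diff[of "\<lambda>_. -1" A B] by simp

lemma reversion_eq: "reversion x = conjugation (main_involution x)"
proof -
  have "(-1 :: real) ^ (k * (k - 1) div 2) = (-1) ^ (k * (k + 1) div 2) * (-1) ^ k" for k :: nat
  proof (cases k)
    case (Suc m)
    have "k * (k + 1) = k * (k - 1) + 2 * k" unfolding Suc by (simp add: algebra_simps)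
    then have "k * (k + 1) div 2 = k * (k - 1) div 2 + k" by simp
    then show ?thesis by (simp add: power_add flip: power_mult_distrib)
  qed simp
  then show ?thesis
    by (simp add: clifford_eq_iff reversion_def conjugation_def main_involution_def)
qed

lemma main_involution_mult:
  fixes x y :: "'n::{finite,linorder} clifford"
  shows "main_involution (x * y) = main_involution x * main_involution y"
proof -
  have b: "main_involution (cl_basis A) = (-1) ^ card A *\<^sub>R (cl_basis A :: 'n clifford)" for A
    by (simp add: clifford_eq_iff main_involution_def)
  note lin = linear_sum[OF linear_involutions(3)] linear_scale[OF linear_involutions(3)]
  have bb: "main_involution (cl_basis A * cl_basis B)
      = main_involution (cl_basis A) * main_involution (cl_basis B :: 'n clifford)" for A B
    by (simp add: b basis_mult lin main_involution_sign mult_ac del: Un_Diff)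
  have "main_involution ((\<Sum>A\<in>UNIV. cl_coeff x A *\<^sub>R cl_basis A) * (\<Sum>B\<in>UNIV. cl_coeff y B *\<^sub>R cl_basis B))
      = main_involution (\<Sum>A\<in>UNIV. cl_coeff x A *\<^sub>R cl_basis A)
        * main_involution (\<Sum>B\<in>UNIV. cl_coeff y B *\<^sub>R cl_basis B)"
    by (simp add: sum_distrib_left sum_distrib_right lin bb)
  then show ?thesis by (simp flip: clifford_expand)
qed

lemma conjugation_mult:
  fixes x y :: "'n::{finite,linorder} clifford"
  shows "conjugation (x * y) = conjugation y * conjugation x"
proof -
  have b: "conjugation (cl_basis A) = cl_sign A A *\<^sub>R (cl_basis A :: 'n clifford)" for A
    by (simp add: clifford_eq_iff conjugation_def flip: conjugation_sign)
  note lin = linear_sum[OF linear_involutions(1)] linear_scale[OF linear_involutions(1)]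
  have bb: "conjugation (cl_basis A * cl_basis B)
      = conjugation (cl_basis B) * conjugation (cl_basis A :: 'n clifford)" for A B
  proof -
    have "sym_diff A B = sym_diff B A" by blast
    moreover have "cl_sign A B * cl_sign (sym_diff A B) (sym_diff A B)
        = cl_sign B B * (cl_sign A A * cl_sign B A)"
      using cl_sign_square[of A B]
      by (simp add: cl_sign_sym_diff_left cl_sign_sym_diff_right mult_ac del: Un_Diff)
    ultimately show ?thesis
      by (simp add: b basis_mult lin mult_ac del: Un_Diff)
  qed
  have "conjugation ((\<Sum>A\<in>UNIV. cl_coeff x A *\<^sub>R cl_basis A) * (\<Sum>B\<in>UNIV. cl_coeff y B *\<^sub>R cl_basis B))
      = conjugation (\<Sum>B\<in>UNIV. cl_coeff y B *\<^sub>R cl_basis B)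
        * conjugation (\<Sum>A\<in>UNIV. cl_coeff x A *\<^sub>R cl_basis A)"
    unfolding sum_distrib_left sum_distrib_right lin bb
    by (subst sum.swap) (simp add: lin bb mult.commute)
  then show ?thesis by (simp flip: clifford_expand)
qed

lemma reversion_mult:
  fixes x y :: "'n::{finite,linorder} clifford"
  shows "reversion (x * y) = reversion y * reversion x"
  by (simp add: reversion_eq main_involution_mult conjugation_mult)

section \<open>Paravectors and the upper half-space\<close>

text \<open>
  The paravector $x_0 + x_1 e_1 + \dots + x_n e_n$ is represented by the pair of $x_0$ and
  $(x_1,\dots,x_n)$.
\<close>

type_synonym 'n paravector = "real \<times> (real ^ 'n)"

definition cl_of :: "'n::{finite,linorder} paravector \<Rightarrow> 'n clifford" where
  "cl_of x = of_real (fst x) + (\<Sum>i\<in>UNIV. (snd x $ i) *\<^sub>R cl_gen i)"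

lemma cl_coeff_of_real: "cl_coeff (of_real r :: 'n::{finite,linorder} clifford) A = (if A = {} then r else 0)"
  by (simp add: of_real_def one_clifford_def)

lemma inj_cl_of: "inj (cl_of :: 'n::{finite,linorder} paravector \<Rightarrow> 'n clifford)"
proof (rule injI)
  fix x y :: "'n paravector"
  assume eq: "cl_of x = cl_of y"
  have 1: "cl_coeff (cl_of z) {} = fst z" for z :: "'n paravector"
    by (simp add: cl_of_def cl_coeff_of_real cl_gen_def)
  have 2: "cl_coeff (cl_of z) {i} = snd z $ i" for z :: "'n paravector" and i
    by (simp add: cl_of_def cl_coeff_of_real cl_gen_def if_distrib cong: if_cong)
  show "x = y"
    using 1[of x] 1[of y] 2[of x] 2[of y] eq by (simp add: prod_eq_iff vec_eq_iff)
qed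

text \<open>The elements of $\mathbb{R} \oplus \mathbb{R}^p$: the $k$-th index $i$ is the one with
  \<^term>\<open>card {..i} = k\<close>.\<close>

definition paravectors :: "nat \<Rightarrow> 'n::{finite,linorder} clifford set" where
  "paravectors p = cl_of ` {x. \<forall>i. p < card {..i} \<longrightarrow> snd x $ i = 0}"

definition rat_paravectors :: "'n::{finite,linorder} paravector set" where
  "rat_paravectors = {x. fst x \<in> \<rat> \<and> (\<forall>i. snd x $ i \<in> \<rat>)}"

definition last_coord :: "'n::{finite,linorder} paravector \<Rightarrow> real" where
  "last_coord x = snd x $ Max UNIV"

definition upper_half_space :: "'n::{finite,linorder} paravector set" where
  "upper_half_space = {x. last_coord x > 0}"

section \<open>Differential operators\<close>

definition e_zero :: "'n::finite paravector" where
  "e_zero = (1, 0)"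

definition e_vec :: "'n::finite \<Rightarrow> 'n paravector" where
  "e_vec i = (0, axis i 1)"

definition partial :: "'a::real_normed_vector \<Rightarrow> ('a \<Rightarrow> 'b::real_normed_vector) \<Rightarrow> 'a \<Rightarrow> 'b" where
  "partial v f x = vector_derivative (\<lambda>t. f (x + t *\<^sub>R v)) (at 0)"

definition cauchy_riemann ::
  "('n::{finite,linorder} paravector \<Rightarrow> 'n clifford) \<Rightarrow> 'n paravector \<Rightarrow> 'n clifford" where
  "cauchy_riemann f x = partial e_zero f x + (\<Sum>i\<in>UNIV. cl_gen i * partial (e_vec i) f x)"

definition left_monogenic_on ::
  "'n::{finite,linorder} paravector set \<Rightarrow> ('n paravector \<Rightarrow> 'n clifford) \<Rightarrow> bool" where
  "left_monogenic_on S f \<longleftrightarrow> (\<forall>x\<in>S. f differentiable (at x) \<and> cauchy_riemann f x = 0)"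

definition laplace_beltrami ::
  "('n::{finite,linorder} paravector \<Rightarrow> 'n clifford) \<Rightarrow> 'n paravector \<Rightarrow> 'n clifford" where
  "laplace_beltrami g x =
     (last_coord x)\<^sup>2 *\<^sub>R (partial e_zero (partial e_zero g) x
        + (\<Sum>i\<in>UNIV. partial (e_vec i) (partial (e_vec i) g) x))
     - ((real CARD('n) - 1) * last_coord x) *\<^sub>R partial (e_vec (Max UNIV)) g x"

text \<open>As \<^const>\<open>partial\<close> is a total function, the eigenvalue equation only has its intended
  meaning together with the existence of the derivatives.\<close>

definition C2_on :: "'a::real_normed_vector set \<Rightarrow> ('a \<Rightarrow> 'b::real_normed_vector) \<Rightarrow> bool" where
  "C2_on S g \<longleftrightarrow> (\<forall>x\<in>S. g differentiable (at x)) \<and>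
     (\<forall>u. (\<forall>x\<in>S. partial u g differentiable (at x)) \<and>
          (\<forall>v. continuous_on S (partial v (partial u g))))"

section \<open>Vahlen matrices and arithmetic groups\<close>

type_synonym 'n cl_matrix = "'n clifford ^ 2 ^ 2"

definition paravector_products :: "nat \<Rightarrow> 'n::{finite,linorder} clifford set" where
  "paravector_products p = {prod_list ws | ws. set ws \<subseteq> paravectors p}"

definition SAV :: "nat \<Rightarrow> 'n::{finite,linorder} cl_matrix set" where
  "SAV p = {M. let a = M $ 1 $ 1; b = M $ 1 $ 2; c = M $ 2 $ 1; d = M $ 2 $ 2 in
     {a, b, c, d} \<subseteq> paravector_products p \<and>
     a * reversion d - b * reversion c = 1 \<and>
     (a \<noteq> 0 \<longrightarrow> inverse a * b \<in> paravectors p) \<and>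
     (c \<noteq> 0 \<longrightarrow> inverse c * d \<in> paravectors p)}"

definition SAV_rat :: "nat \<Rightarrow> 'n::{finite,linorder} cl_matrix set" where
  "SAV_rat p = {M \<in> SAV p. let a = M $ 1 $ 1; b = M $ 1 $ 2; c = M $ 2 $ 1; d = M $ 2 $ 2 in
     {a * conjugation a, b * conjugation b, c * conjugation c, d * conjugation d}
        \<subseteq> of_real ` \<rat> \<and>
     {a * conjugation c, b * conjugation d} \<subseteq> cl_of ` rat_paravectors \<and>
     (\<forall>x \<in> cl_of ` rat_paravectors.
        a * x * conjugation b + b * conjugation x * conjugation a \<in> of_real ` \<rat> \<and>
        c * x * conjugation d + d * conjugation x * conjugation c \<in> of_real ` \<rat>) \<and>
     (\<forall>x \<in> cl_of ` rat_paravectors.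
        a * x * conjugation d + b * conjugation x * conjugation c \<in> cl_of ` rat_paravectors)}"

definition rat_clifford :: "'n clifford set" where
  "rat_clifford = {x. \<forall>A. cl_coeff x A \<in> \<rat>}"

interpretation int_mod: module "\<lambda>(k :: int) (x :: 'n::{finite,linorder} clifford). of_int k * x"
  by unfold_locales (simp_all add: algebra_simps)

interpretation rat_vec: vector_space "\<lambda>(q :: rat) (x :: 'n clifford). real_of_rat q *\<^sub>R x"
  by unfold_locales (simp_all add: algebra_simps of_rat_add of_rat_mult)

definition is_Z_order :: "'n::{finite,linorder} clifford set \<Rightarrow> bool" where
  "is_Z_order I \<longleftrightarrow>
     I \<subseteq> rat_clifford \<and>
     1 \<in> I \<and> (\<forall>x\<in>I. \<forall>y\<in>I. x - y \<in> I \<and> x * y \<in> I) \<and>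
     (\<exists>S. finite S \<and> int_mod.span S = I) \<and>
     (\<exists>B \<subseteq> I. rat_vec.independent B \<and> rat_vec.span B = rat_clifford)"

definition Gamma :: "nat \<Rightarrow> 'n::{finite,linorder} clifford set \<Rightarrow> 'n cl_matrix set" where
  "Gamma p I = {M \<in> SAV_rat p. \<forall>i j. M $ i $ j \<in> I}"

definition Gamma_cong ::
  "nat \<Rightarrow> 'n::{finite,linorder} clifford set \<Rightarrow> nat \<Rightarrow> 'n cl_matrix set" where
  "Gamma_cong p I N = {M \<in> Gamma p I.
     {M $ 1 $ 1 - 1, M $ 1 $ 2, M $ 2 $ 1, M $ 2 $ 2 - 1} \<subseteq> (\<lambda>y. of_nat N * y) ` I}"

definition cocycle :: "'n::{finite,linorder} cl_matrix \<Rightarrow> 'n paravector \<Rightarrow> 'n clifford" where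
  "cocycle M x = M $ 2 $ 1 * cl_of x + M $ 2 $ 2"

text \<open>$(ax+b)(cx+d)^{-1}$ is a Clifford element; the inverse of the embedding turns it back
  into a pair of coordinates.\<close>

definition moebius :: "'n::{finite,linorder} cl_matrix \<Rightarrow> 'n paravector \<Rightarrow> 'n paravector" where
  "moebius M x = inv cl_of ((M $ 1 $ 1 * cl_of x + M $ 1 $ 2) * inverse (cocycle M x))"

definition automorphic_on ::
  "'n::{finite,linorder} cl_matrix set \<Rightarrow> ('n cl_matrix \<Rightarrow> 'n paravector \<Rightarrow> 'n clifford) \<Rightarrow>
   ('n paravector \<Rightarrow> 'n clifford) \<Rightarrow> bool" where
  "automorphic_on G j f \<longleftrightarrow>
     (\<forall>x\<in>upper_half_space. \<forall>M\<in>G. f x = j M x * f (moebius M x))"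

end

theory Submission
  imports Defs
begin

text \<open>
  Since a Vahlen matrix over $\mathbb{R} \oplus \mathbb{R}^p$ with $p < n$ satisfies
  $(M\langle x\rangle)_n = x_n / \|cx+d\|^2$, multiplication by $x_n^{(n-1)/2}$ turns the automorphy
  factor of weight $n$ into the stated one.  The eigenvalue equation is a computation once $f$ is
  twice continuously differentiable and harmonic, but a monogenic function is only assumed to be
  differentiable at each point.  Regularity therefore rests on a Goursat argument: for differentiable
  compactly supported $F_b$ with $\sum_b \partial_b F_b = g$ continuous, $\int g = 0$.  If not, the weak
  divergence defect of $F$ against some spline bump is nonzero; the two-scale relation of splines
  yields ever smaller bumps, shrinking to a point, whose defect relative to volume does not
  decrease, contradicting differentiability at that point.  Applied to
  $F_b(y) = \kappa_r(y) \bar y e_b f(x+y)$ for a radial kernel $\kappa_r$, this shows that the radial mean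
  of $f$ at $x$ does not depend on $r$.  So $f$ is locally its own convolution with a $C^2$ kernel.
\<close>

section \<open>Divergence theorem for differentiable fields\<close>

text \<open>Differentiability at each point does not by itself make the partial derivatives of
  \<open>f\<close> continuous or integrable, so neither the usual divergence theorem nor
  differentiation of averages of \<open>f\<close> under the integral sign is available at the start.
  What is continuous is the divergence alone: in the field built from \<open>f\<close>, the
  derivatives of \<open>f\<close> enter the divergence only through conj(y) Df(x+y), which vanishes,
  and the remaining terms contain just \<open>f\<close> and the kernel. Hence the divergence theorem
  is shaped for a merely differentiable field with continuous divergence. Bumps take the place of
  cubes because pairing with a bump needs no boundary integrals, while a spline bump still splits
  exactly into smaller ones. The radial kernel is the third power of a truncated quadratic, and this
  exponent leaves its second derivatives continuous. The power (n-1)/2 of x_n does double duty: it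
  absorbs the excess |cx+d|^(n-1) of the automorphy factor, and it is the exponent for which the
  first-order terms of the Laplace-Beltrami operator cancel.\<close>

lemma has_real_derivative_max_power:
  "((\<lambda>t::real. max 0 t ^ (n + 2)) has_real_derivative real (n + 2) * max 0 t ^ (n + 1)) (at t)"
proof -
  consider "t > 0" | "t < 0" | "t = 0" by linarith
  then show ?thesis
  proof cases
    case 1
    have "((\<lambda>t::real. t ^ (n + 2)) has_real_derivative real (n + 2) * t ^ (n + 1)) (at t)"
      using DERIV_pow[of "n + 2" t] by simp
    then have "((\<lambda>t::real. max 0 t ^ (n + 2)) has_real_derivative real (n + 2) * t ^ (n + 1)) (at t)"
      by (rule has_field_derivative_transform_within_open[of _ _ _ "{0<..}"]) (use 1 in auto)
    with 1 show ?thesis by simp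
  next
    case 2
    have "((\<lambda>t::real. 0) has_real_derivative 0) (at t)" by simp
    then have "((\<lambda>t::real. max 0 t ^ (n + 2)) has_real_derivative 0) (at t)"
      by (rule has_field_derivative_transform_within_open[of _ _ _ "{..<0}"]) (use 2 in auto)
    with 2 show ?thesis by simp
  next
    \<comment> \<open>At the kink the difference quotient is at most |h|^(n+1), and n + 1 is
      positive even for n = 0.\<close>
    case 3
    have "((\<lambda>h::real. max 0 h ^ (n + 2) / h) \<longlongrightarrow> 0) (at 0)"
    proof (rule Lim_null_comparison)
      have "norm (max 0 h ^ (n + 2) / h) \<le> \<bar>h\<bar> ^ (n + 1)" for h :: real
        using zero_le_power[of "\<bar>h\<bar>" "n + 1"]
        by (cases "h > 0") (auto simp: power_add simp del: zero_le_power_abs)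
      then show "\<forall>\<^sub>F h::real in at 0. norm (max 0 h ^ (n + 2) / h) \<le> \<bar>h\<bar> ^ (n + 1)"
        by simp
      show "((\<lambda>h::real. \<bar>h\<bar> ^ (n + 1)) \<longlongrightarrow> 0) (at 0)"
        by (auto intro!: tendsto_eq_intros)
    qed
    with 3 show ?thesis by (simp add: DERIV_def)
  qed
qed

section \<open>Compactly supported integrands\<close>

lemma integral_eq_integral_UNIV:
  fixes f :: "'a::euclidean_space \<Rightarrow> 'b::banach"
  assumes "\<And>x. x \<notin> S \<Longrightarrow> f x = 0"
  shows "integral S f = integral UNIV f"
proof -
  have "f = (\<lambda>x. if x \<in> S then f x else 0)" using assms by auto
  then show ?thesis by (metis integral_restrict_UNIV)
qed

lemma integrable_on_UNIV_compact_support: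
  fixes f :: "'a::euclidean_space \<Rightarrow> 'b::banach"
  assumes "continuous_on UNIV f" "\<And>x. x \<notin> cbox l r \<Longrightarrow> f x = 0"
  shows "f integrable_on UNIV"
  by (rule integrable_on_superset[of _ "cbox l r"])
    (auto intro: assms integrable_continuous continuous_on_subset[OF assms(1)])

text \<open>Translation along \<open>b\<close> does not change the integral of \<open>u\<close>, so
  \<open>J\<close> is constant on [0,1]; the Leibniz rule identifies its derivative at 0 with the
  integral of the directional derivative.\<close>

lemma has_integral_directional_derivative_0:
  fixes u :: "'a::euclidean_space \<Rightarrow> 'b::euclidean_space"
  assumes u': "\<And>y. (u has_derivative u' y) (at y)"
    and cont: "continuous_on UNIV (\<lambda>y. u' y b)"
    and supp: "\<And>y. y \<notin> cbox l r \<Longrightarrow> u y = 0"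
  shows "((\<lambda>y. u' y b) has_integral 0) UNIV"
proof -
  \<comment> \<open>A box holding every translate of the support with 0 <= t <= 1, so that the
    domain of integration does not move with \<open>t\<close>.\<close>
  have "compact ((\<lambda>(t, z). z - t *\<^sub>R b) ` ({0..1} \<times> cbox l r))"
    by (intro compact_continuous_image compact_Times)
      (auto intro!: continuous_intros simp: case_prod_unfold)
  then obtain a where a: "(\<lambda>(t, z). z - t *\<^sub>R b) ` ({0..1} \<times> cbox l r) \<subseteq> cbox (-a) a"
    using bounded_subset_cbox_symmetric compact_imp_bounded by metis
  have sub: "z \<in> cbox (-a) a" if "z + t *\<^sub>R b \<in> cbox l r" "t \<in> {0..1}" for z t
    using a that by (force simp: image_subset_iff)
  have cu: "continuous_on UNIV u"
    using u' by (meson continuous_at_imp_continuous_on has_derivative_continuous)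
  define J where "J t = integral (cbox (-a) a) (\<lambda>z. u (z + t *\<^sub>R b))" for t
  have J: "J t = integral (cbox l r) u" if "t \<in> {0..1}" for t
  proof -
    have "(u has_integral integral (cbox l r) u) (cbox l r)"
      by (intro integrable_integral integrable_continuous continuous_on_subset[OF cu]) auto
    then have sh: "((\<lambda>z. u (z + t *\<^sub>R b)) has_integral integral (cbox l r) u)
        (cbox (l - t *\<^sub>R b) (r - t *\<^sub>R b))"
      by (rule has_integral_shift_cbox)
    have eq: "z \<in> cbox (l - t *\<^sub>R b) (r - t *\<^sub>R b) \<longleftrightarrow> z + t *\<^sub>R b \<in> cbox l r" for z
      by (auto simp: mem_box algebra_simps)
    have "((\<lambda>z. u (z + t *\<^sub>R b)) has_integral integral (cbox l r) u) (cbox (-a) a)"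
      by (rule has_integral_on_superset[OF sh]) (use eq supp sub that in auto)
    then show ?thesis unfolding J_def by (rule integral_unique)
  qed
  have "(J has_vector_derivative integral (cbox (-a) a) (\<lambda>z. u' (z + 0 *\<^sub>R b) b)) (at 0 within {0..1})"
    unfolding J_def
  proof (rule leibniz_rule_vector_derivative)
    fix t z
    have "((\<lambda>t. u (z + t *\<^sub>R b)) has_derivative (\<lambda>h. u' (z + t *\<^sub>R b) (h *\<^sub>R b))) (at t within {0..1})"
      by (rule has_derivative_compose[OF _ u']) (auto intro!: derivative_eq_intros)
    then show "((\<lambda>t. u (z + t *\<^sub>R b)) has_vector_derivative u' (z + t *\<^sub>R b) b) (at t within {0..1})"
      by (simp add: has_vector_derivative_def linear_scale has_derivative_linear[OF u'])
    show "(\<lambda>z. u (z + t *\<^sub>R b)) integrable_on cbox (-a) a"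
      by (intro integrable_continuous continuous_on_compose2[OF cu] continuous_intros) auto
  next
    show "continuous_on ({0..1} \<times> cbox (- a) a) (\<lambda>(t, z). u' (z + t *\<^sub>R b) b)"
      unfolding case_prod_unfold
      by (intro continuous_on_compose2[OF cont] continuous_intros) auto
  qed auto
  moreover have "(J has_vector_derivative 0) (at 0 within {0..1})"
    by (rule has_vector_derivative_transform[where f="\<lambda>_. integral (cbox l r) u"])
      (auto simp: J)
  ultimately have 0: "integral (cbox (-a) a) (\<lambda>z. u' z b) = 0"
    using vector_derivative_unique_within_closed_interval[of 0 1 0 J] by force
  \<comment> \<open>Off the closed box \<open>u\<close> vanishes on an open set, hence so does its
    derivative; this carries the result from a box to the whole space.\<close>
  have z: "u' y b = 0" if "y \<notin> cbox l r" for y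
  proof -
    have "(u has_derivative (\<lambda>_. 0)) (at y)"
      by (rule has_derivative_transform_within_open[of "\<lambda>_. 0" _ _ _ "- cbox l r"])
        (use that supp in \<open>auto simp: open_Compl\<close>)
    then show ?thesis using has_derivative_unique[OF u'] by metis
  qed
  have "integral UNIV (\<lambda>z. u' z b) = 0"
    using 0 integral_eq_integral_UNIV[of "cbox (-a) a" "\<lambda>z. u' z b"] z sub[of _ 0] by force
  moreover have "(\<lambda>z. u' z b) integrable_on UNIV"
    by (rule integrable_on_UNIV_compact_support[OF cont z])
  ultimately show ?thesis by (metis integrable_integral)
qed

section \<open>Quadratic B-splines and their tensor products\<close>

definition bspline :: "real \<Rightarrow> real" where
  "bspline t = (max 0 t)\<^sup>2 - 3 * (max 0 (t - 1))\<^sup>2 + 3 * (max 0 (t - 2))\<^sup>2 - (max 0 (t - 3))\<^sup>2"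

definition bspline' :: "real \<Rightarrow> real" where
  "bspline' t = 2 * (max 0 t - 3 * max 0 (t - 1) + 3 * max 0 (t - 2) - max 0 (t - 3))"

lemma has_derivative_bspline: "(bspline has_real_derivative bspline' t) (at t)"
proof -
  have 1: "((\<lambda>t::real. (max 0 t)\<^sup>2) has_real_derivative 2 * max 0 t) (at t)" for t
    using has_real_derivative_max_power[of 0 t] by (simp add: numeral_2_eq_2)
  have 2: "((\<lambda>t::real. (max 0 (t - c))\<^sup>2) has_real_derivative 2 * max 0 (t - c)) (at t)" for c t
    using DERIV_shift[of "\<lambda>t. (max 0 t)\<^sup>2" "2 * max 0 (t - c)" t "- c"] 1[of "t - c"] by simp
  have "(bspline has_real_derivative 2 * max 0 t - 3 * (2 * max 0 (t - 1))
      + 3 * (2 * max 0 (t - 2)) - 2 * max 0 (t - 3)) (at t)"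
    unfolding bspline_def[abs_def] by (intro DERIV_diff DERIV_add DERIV_cmult 1 2)
  then show ?thesis by (simp add: bspline'_def)
qed

lemma continuous_bspline: "continuous_on S bspline" "continuous_on S bspline'"
  unfolding bspline_def[abs_def] bspline'_def[abs_def] by (intro continuous_intros)+

lemma bspline_support: "t \<notin> {0..3} \<Longrightarrow> bspline t = 0" "t \<notin> {0..3} \<Longrightarrow> bspline' t = 0"
  by (auto simp: bspline_def bspline'_def max_def power2_eq_square algebra_simps)

text \<open>\<open>bspline\<close> is the third backward difference of the truncated square, twice
  the cardinal quadratic B-spline on [0,3]. With z the shift by half a step, (1 - z^2)^3 = (1 + z)^3
  (1 - z)^3 yields the binomial coefficients; the denominator 4 is 2^2, from rescaling the truncated
  square. Differentiation contributes the extra factor 2.\<close>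

lemma bspline_refine:
  "bspline t = (\<Sum>k\<le>3::nat. real (3 choose k) / 4 * bspline (2 * t - real k))"
  "bspline' t = 2 * (\<Sum>k\<le>3::nat. real (3 choose k) / 4 * bspline' (2 * t - real k))"
proof -
  \<comment> \<open>Truncation commutes with the positive factor 2. The knots at even shifts then
    match the left-hand side, and those at odd shifts cancel among themselves.\<close>
  have e: "max 0 (2 * t - 2 * c) = 2 * max 0 (t - c)" for c
    using max_mult_distrib_left[of 2 0 "t - c"] by (simp add: algebra_simps)
  note e' = e[of 0, simplified] e[of 1, simplified] e[of 2, simplified] e[of 3, simplified]
  have sum3: "(\<Sum>k\<le>3::nat. real (3 choose k) / 4 * h (2 * t - real k))
      = (h (2 * t) + 3 * h (2 * t - 1) + 3 * h (2 * t - 2) + h (2 * t - 3)) / 4" for h :: "real \<Rightarrow> real"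
    by (simp add: numeral_3_eq_3 field_simps)
  have d: "2 * t - 1 - 1 = 2 * t - 2" "2 * t - 1 - 2 = 2 * t - 3" "2 * t - 1 - 3 = 2 * t - 4"
    "2 * t - 2 - 1 = 2 * t - 3" "2 * t - 2 - 2 = 2 * t - 4" "2 * t - 2 - 3 = 2 * t - 5"
    "2 * t - 3 - 1 = 2 * t - 4" "2 * t - 3 - 2 = 2 * t - 5" "2 * t - 3 - 3 = 2 * t - 6"
    by simp_all
  show "bspline t = (\<Sum>k\<le>3::nat. real (3 choose k) / 4 * bspline (2 * t - real k))"
    unfolding sum3[of bspline] unfolding bspline_def d e' by algebra
  show "bspline' t = 2 * (\<Sum>k\<le>3::nat. real (3 choose k) / 4 * bspline' (2 * t - real k))"
    unfolding sum3[of bspline'] unfolding bspline'_def d e' by algebra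
qed

text \<open>The tensor product of B-splines satisfies a two-scale relation with positive coefficients,
  which replaces the subdivision of cubes in the argument of Goursat.\<close>

definition cube_spline :: "'a::euclidean_space \<Rightarrow> real" where
  "cube_spline y = (\<Prod>c\<in>Basis. bspline (y \<bullet> c))"

definition cube_spline' :: "'a::euclidean_space \<Rightarrow> 'a \<Rightarrow> real" where
  "cube_spline' b y = (\<Prod>c\<in>Basis. (if c = b then bspline' else bspline) (y \<bullet> c))"

definition grid_vec :: "('a::euclidean_space \<Rightarrow> nat) \<Rightarrow> 'a" where
  "grid_vec \<kappa> = (\<Sum>c\<in>Basis. real (\<kappa> c) *\<^sub>R c)"

definition grid :: "('a::euclidean_space \<Rightarrow> nat) set" where
  "grid = (\<Pi>\<^sub>E c\<in>Basis. {..3})"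

definition grid_weight :: "('a::euclidean_space \<Rightarrow> nat) \<Rightarrow> real" where
  "grid_weight \<kappa> = (\<Prod>c\<in>Basis. real (3 choose \<kappa> c) / 4)"

lemma finite_grid: "finite grid"
  unfolding grid_def by (intro finite_PiE) auto

lemma grid_vec_inner: "c \<in> Basis \<Longrightarrow> grid_vec \<kappa> \<bullet> c = real (\<kappa> c)"
  unfolding grid_vec_def by (simp add: inner_sum_left inner_Basis if_distrib cong: if_cong)

lemma grid_weight_nonneg: "0 \<le> grid_weight \<kappa>"
  unfolding grid_weight_def by (intro prod_nonneg) auto

text \<open>In each coordinate the weights 1, 3, 3, 1 over 4 add up to 2. The total is the inverse
  of the factor by which halving shrinks the volume of a cube; this balance keeps the defect per
  unit volume from decaying under refinement.\<close>

lemma sum_grid_weight: "(\<Sum>\<kappa>\<in>grid. grid_weight (\<kappa> :: 'a::euclidean_space \<Rightarrow> nat)) = 2 ^ DIM('a)"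
proof -
  have "(\<Sum>\<kappa>\<in>grid. grid_weight (\<kappa> :: 'a \<Rightarrow> nat))
      = (\<Prod>c\<in>(Basis :: 'a set). \<Sum>k\<le>3. real (3 choose k) / 4)"
    unfolding grid_weight_def grid_def by (rule prod_sum_PiE[symmetric]) auto
  also have "(\<Sum>k\<le>3::nat. real (3 choose k) / 4) = 2"
    by (simp add: numeral_3_eq_3)
  finally show ?thesis by simp
qed

lemma cube_spline_refine:
  "cube_spline z = (\<Sum>\<kappa>\<in>grid. grid_weight \<kappa> * cube_spline (2 *\<^sub>R z - grid_vec \<kappa>))"
  unfolding cube_spline_def
  by (subst bspline_refine, subst prod_sum_PiE)
    (auto simp: grid_def grid_weight_def grid_vec_inner inner_diff_left simp flip: prod.distrib
      intro!: sum.cong prod.cong)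

text \<open>The factor 2 comes from the one differentiated coordinate; it is what turns the scale
  \<open>s\<close> in front of the gradient into \<open>2 * s\<close> in
  \<open>spline_pairing_refine\<close>.\<close>

lemma cube_spline'_refine:
  assumes "b \<in> Basis"
  shows "cube_spline' b z
    = 2 * (\<Sum>\<kappa>\<in>grid. grid_weight \<kappa> * cube_spline' b (2 *\<^sub>R z - grid_vec \<kappa>))"
proof -
  have "(if c = b then bspline' else bspline) t = (if c = b then 2 else 1) *
      (\<Sum>k\<le>3::nat. real (3 choose k) / 4 * (if c = b then bspline' else bspline) (2 * t - real k))"
    for t and c
    using bspline_refine[of t] by simp
  then have "cube_spline' b z = (\<Prod>c\<in>Basis. (if c = b then 2 else 1) *
      (\<Sum>k\<le>3::nat. real (3 choose k) / 4 * (if c = b then bspline' else bspline) (2 * (z \<bullet> c) - real k)))"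
    unfolding cube_spline'_def by (intro prod.cong refl)
  also have "\<dots> = 2 * (\<Prod>c\<in>Basis.
      (\<Sum>k\<le>3::nat. real (3 choose k) / 4 * (if c = b then bspline' else bspline) (2 * (z \<bullet> c) - real k)))"
    using assms by (simp add: prod.distrib)
  also have "\<dots> = 2 * (\<Sum>\<kappa>\<in>grid. grid_weight \<kappa> * cube_spline' b (2 *\<^sub>R z - grid_vec \<kappa>))"
    unfolding cube_spline'_def
    by (subst prod_sum_PiE)
      (auto simp: grid_def grid_weight_def grid_vec_inner inner_diff_left simp flip: prod.distrib
        intro!: sum.cong prod.cong)
  finally show ?thesis .
qed

lemma has_derivative_cube_spline:
  "(cube_spline has_derivative (\<lambda>v. \<Sum>b\<in>Basis. (v \<bullet> b) * cube_spline' b y)) (at y)"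
proof -
  have 1: "((\<lambda>y. bspline (y \<bullet> c)) has_derivative (\<lambda>v. (v \<bullet> c) * bspline' (y \<bullet> c))) (at y)" for c
    using has_derivative_compose[OF bounded_linear_imp_has_derivative[OF bounded_linear_inner_left]
        has_derivative_bspline[unfolded has_field_derivative_def]]
    by (simp add: mult.commute)
  have 2: "cube_spline' b y = bspline' (y \<bullet> b) * (\<Prod>c\<in>Basis - {b}. bspline (y \<bullet> c))"
    if "b \<in> Basis" for b
    unfolding cube_spline'_def using that by (subst prod.remove[of _ b]) (auto intro!: prod.cong)
  show ?thesis
    unfolding cube_spline_def[abs_def]
    by (rule has_derivative_eq_rhs, rule has_derivative_prod, rule 1)
      (auto simp: 2 mult.assoc intro!: sum.cong)
qed

lemma continuous_cube_spline: "continuous_on S cube_spline" "continuous_on S (cube_spline' b)"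
  unfolding cube_spline_def[abs_def] cube_spline'_def[abs_def]
  by (intro continuous_intros continuous_on_compose2[OF continuous_bspline(1)[of UNIV]]
    continuous_on_compose2[OF continuous_bspline(2)[of UNIV]]; simp)
    (auto intro!: continuous_intros continuous_on_compose2[OF continuous_bspline(1)[of UNIV]]
    continuous_on_compose2[OF continuous_bspline(2)[of UNIV]])

lemma cube_spline_support:
  assumes "z \<notin> cbox 0 (3 *\<^sub>R One)"
  shows "cube_spline z = 0" "cube_spline' b z = 0"
proof -
  obtain c where "c \<in> Basis" "z \<bullet> c \<notin> {0..3}"
    using assms by (auto simp: mem_box)
  then show "cube_spline z = 0" "cube_spline' b z = 0"
    unfolding cube_spline_def cube_spline'_def
    by (auto intro!: bexI[of _ c] simp: prod_zero_iff bspline_support)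
qed

lemma cube_spline_bounded:
  obtains B where "B \<ge> 0" "\<And>z. \<bar>cube_spline (z::'a::euclidean_space)\<bar> \<le> B"
    "\<And>b z. b \<in> Basis \<Longrightarrow> \<bar>cube_spline' b (z::'a)\<bar> \<le> B"
proof -
  have *: "\<exists>B\<ge>0. \<forall>z. \<bar>h z\<bar> \<le> B"
    if "continuous_on UNIV h" "\<And>z. z \<notin> cbox 0 (3 *\<^sub>R One) \<Longrightarrow> h z = 0" for h :: "'a \<Rightarrow> real"
  proof -
    have "bounded (h ` cbox 0 (3 *\<^sub>R One))"
      by (intro compact_imp_bounded compact_continuous_image compact_cbox
          continuous_on_subset[OF that(1)]) auto
    then obtain B where B: "\<And>z. z \<in> cbox 0 (3 *\<^sub>R One) \<Longrightarrow> \<bar>h z\<bar> \<le> B"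
      unfolding bounded_iff by auto
    have "\<bar>h z\<bar> \<le> max 0 B" for z
      using B[of z] that(2)[of z] by (cases "z \<in> cbox 0 (3 *\<^sub>R One)") auto
    then show ?thesis by (intro exI[of _ "max 0 B"]) auto
  qed
  obtain B0 where B0: "B0 \<ge> 0" "\<And>z::'a. \<bar>cube_spline z\<bar> \<le> B0"
    using *[OF continuous_cube_spline(1) cube_spline_support(1)] by blast
  have "\<exists>B\<ge>0. \<forall>z::'a. \<bar>cube_spline' b z\<bar> \<le> B" for b :: 'a
    using *[OF continuous_cube_spline(2) cube_spline_support(2)] by blast
  then obtain B' where B': "\<And>b. B' b \<ge> 0" "\<And>b (z::'a). \<bar>cube_spline' b z\<bar> \<le> B' b"
    by metis
  show ?thesis
  proof (rule that[of "B0 + sum B' Basis"])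
    show "0 \<le> B0 + sum B' Basis" "\<bar>cube_spline z\<bar> \<le> B0 + sum B' Basis" for z :: 'a
      using B0(1) B0(2)[of z] sum_nonneg[of Basis B'] B'(1) by force+
    show "\<bar>cube_spline' b z\<bar> \<le> B0 + sum B' Basis" if "b \<in> Basis" for b z :: 'a
      using B0(1) B'(2)[where b=b and z=z] member_le_sum[of b Basis B'] B'(1) that by force
  qed
qed

text \<open>Each coordinate contributes 9/4 - 3/4 = 3/2. The centre is where the bump ends up being
  evaluated when it is stretched without bound.\<close>

lemma cube_spline_center_nonzero: "cube_spline ((3/2) *\<^sub>R One) \<noteq> 0"
  unfolding cube_spline_def by (auto simp: prod_zero_iff bspline_def power2_eq_square)

text \<open>With psi(y) = \<open>cube_spline (s *\<^sub>R y + t)\<close> this is grad psi . F + psi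
  g, formally the divergence of psi F when \<open>g\<close> is that of \<open>F\<close>. No
  derivative of \<open>F\<close> occurs, so it is continuous for continuous \<open>F\<close> and
  \<open>g\<close>; its integral is the weak divergence defect.\<close>

definition spline_pairing ::
  "('a::euclidean_space \<Rightarrow> 'a \<Rightarrow> 'b) \<Rightarrow> ('a \<Rightarrow> 'b) \<Rightarrow> real \<Rightarrow> 'a \<Rightarrow> 'a \<Rightarrow> 'b::euclidean_space"
  where "spline_pairing F g s t y = (\<Sum>b\<in>Basis. (s * cube_spline' b (s *\<^sub>R y + t)) *\<^sub>R F b y)
      + cube_spline (s *\<^sub>R y + t) *\<^sub>R g y"

lemma continuous_spline_pairing:
  assumes "\<And>b. b \<in> Basis \<Longrightarrow> continuous_on S (F b)" "continuous_on S g"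
  shows "continuous_on S (spline_pairing F g s t)"
  unfolding spline_pairing_def[abs_def]
  by (intro continuous_intros assms continuous_on_compose2[OF continuous_cube_spline(1)[of UNIV]]
    continuous_on_compose2[OF continuous_cube_spline(2)[of UNIV]]) auto

lemma spline_pairing_refine:
  "spline_pairing F g s t y
    = (\<Sum>\<kappa>\<in>grid. grid_weight \<kappa> *\<^sub>R spline_pairing F g (2 * s) (2 *\<^sub>R t - grid_vec \<kappa>) y)"
proof -
  have e: "2 *\<^sub>R (s *\<^sub>R y + t) - v = (2 * s) *\<^sub>R y + (2 *\<^sub>R t - v)" for v
    by (simp add: algebra_simps)
  have "(\<Sum>b\<in>Basis. (s * cube_spline' b (s *\<^sub>R y + t)) *\<^sub>R F b y)
    = (\<Sum>b\<in>Basis. \<Sum>\<kappa>\<in>grid. grid_weight \<kappa> *\<^sub>R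
        (((2 * s) * cube_spline' b ((2 * s) *\<^sub>R y + (2 *\<^sub>R t - grid_vec \<kappa>))) *\<^sub>R F b y))"
    by (intro sum.cong refl)
      (simp add: cube_spline'_refine[where z="s *\<^sub>R y + t"] e sum_distrib_left
        scaleR_sum_left[symmetric] mult_ac)
  also have "\<dots> = (\<Sum>\<kappa>\<in>grid. \<Sum>b\<in>Basis. grid_weight \<kappa> *\<^sub>R
        (((2 * s) * cube_spline' b ((2 * s) *\<^sub>R y + (2 *\<^sub>R t - grid_vec \<kappa>))) *\<^sub>R F b y))"
    by (rule sum.swap)
  finally show ?thesis
    unfolding spline_pairing_def scaleR_add_right sum.distrib scaleR_sum_right
    by (simp add: cube_spline_refine[of "s *\<^sub>R y + t"] e scaleR_sum_left)
qed

lemma scaled_cube_iff: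
  fixes y t :: "'a::euclidean_space"
  assumes "s > 0"
  shows "y \<in> cbox (- t /\<^sub>R s) ((3 *\<^sub>R One - t) /\<^sub>R s) \<longleftrightarrow> s *\<^sub>R y + t \<in> cbox 0 (3 *\<^sub>R One)"
  using assms by (auto simp: mem_box field_simps inner_simps)

text \<open>The product of an affine field with the bump is continuously differentiable, so each
  derivative along \<open>b\<close> integrates to zero, and the pairing is the sum of these
  derivatives. The field has the form of a first-order Taylor polynomial at \<open>p\<close>, paired
  with its constant divergence.\<close>

lemma spline_pairing_affine:
  fixes p :: "'a::euclidean_space" and G :: "'a \<Rightarrow> 'a \<Rightarrow> 'b::euclidean_space"
  assumes "\<And>b. b \<in> Basis \<Longrightarrow> linear (G b)" and "s > 0"
  shows "(spline_pairing (\<lambda>b y. c b + G b (y - p)) (\<lambda>_. \<Sum>b\<in>Basis. G b b) s t has_integral 0) UNIV"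
proof -
  let ?h = "\<lambda>y::'a. s *\<^sub>R y + t"
  let ?D = "\<lambda>b y v. cube_spline (?h y) *\<^sub>R G b v
      + (\<Sum>d\<in>Basis. (s * (v \<bullet> d)) * cube_spline' d (?h y)) *\<^sub>R (c b + G b (y - p))"
  have supp: "?h y \<notin> cbox 0 (3 *\<^sub>R One)"
    if "y \<notin> cbox (- t /\<^sub>R s) ((3 *\<^sub>R One - t) /\<^sub>R s)" for y
    using that scaled_cube_iff[OF \<open>s > 0\<close>] by blast
  have 1: "((\<lambda>y. ?D b y b) has_integral 0) UNIV" if b: "b \<in> Basis" for b
  proof (rule has_integral_directional_derivative_0[where u'="?D b"
        and u="\<lambda>y. cube_spline (?h y) *\<^sub>R (c b + G b (y - p))"])
    have G: "(G b has_derivative G b) F" for F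
      using assms(1)[OF b] by (simp add: linear_conv_bounded_linear bounded_linear_imp_has_derivative)
    have 2: "((\<lambda>y. G b (y - p)) has_derivative G b) (at y)" for y
      by (rule has_derivative_compose[OF _ G, of "\<lambda>y. y - p" "\<lambda>v. v"]) (auto intro!: derivative_eq_intros)
    have 3: "((\<lambda>y. cube_spline (?h y)) has_derivative
        (\<lambda>v. \<Sum>d\<in>Basis. (s * (v \<bullet> d)) * cube_spline' d (?h y))) (at y)" for y
      by (rule has_derivative_eq_rhs, rule has_derivative_compose[OF _ has_derivative_cube_spline, of ?h "\<lambda>v. s *\<^sub>R v"])
        (auto intro!: derivative_eq_intros)
    show "((\<lambda>y. cube_spline (?h y) *\<^sub>R (c b + G b (y - p))) has_derivative ?D b y) (at y)" for y
      by (rule has_derivative_eq_rhs, rule has_derivative_scaleR[OF 3])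
        (auto intro!: derivative_eq_intros 2)
    have cG: "continuous_on UNIV (\<lambda>y. G b (y - p))"
      using 2 by (meson continuous_at_imp_continuous_on has_derivative_continuous)
    have cs: "continuous_on UNIV (\<lambda>y. cube_spline (?h y))" "continuous_on UNIV (\<lambda>y. cube_spline' d (?h y))" for d
      by (rule continuous_on_compose2[OF continuous_cube_spline(1)[of UNIV]]
        continuous_on_compose2[OF continuous_cube_spline(2)[of UNIV]];
        auto intro!: continuous_intros)+
    show "continuous_on UNIV (\<lambda>y. ?D b y b)"
      by (intro continuous_on_add continuous_on_scaleR continuous_on_sum continuous_on_mult
          continuous_on_const cG cs)
    show "cube_spline (?h y) *\<^sub>R (c b + G b (y - p)) = 0"
      if "y \<notin> cbox (- t /\<^sub>R s) ((3 *\<^sub>R One - t) /\<^sub>R s)" for y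
      using cube_spline_support(1)[OF supp[OF that]] by simp
  qed
  \<comment> \<open>Differentiating along \<open>b\<close> picks the single coordinate d = b out of
    the gradient of the bump.\<close>
  have 4: "?D b y b = (s * cube_spline' b (?h y)) *\<^sub>R (c b + G b (y - p)) + cube_spline (?h y) *\<^sub>R G b b"
    if b: "b \<in> Basis" for b y
  proof -
    have "(\<Sum>d\<in>Basis. (s * (b \<bullet> d)) * cube_spline' d (?h y))
        = (\<Sum>d\<in>Basis. if d = b then s * cube_spline' b (?h y) else 0)"
      using b by (intro sum.cong) (auto simp: inner_Basis)
    also have "\<dots> = s * cube_spline' b (?h y)" using b by simp
    finally show ?thesis by simp
  qed
  have "((\<lambda>y. \<Sum>b\<in>Basis. ?D b y b) has_integral (\<Sum>b\<in>(Basis::'a set). 0)) UNIV"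
    by (intro has_integral_sum 1) auto
  also have "(\<lambda>y. \<Sum>b\<in>Basis. ?D b y b)
      = spline_pairing (\<lambda>b y. c b + G b (y - p)) (\<lambda>_. \<Sum>b\<in>Basis. G b b) s t"
    unfolding spline_pairing_def[abs_def] by (rule ext) (simp add: 4 sum.distrib scaleR_sum_right)
  finally show ?thesis by simp
qed

text \<open>After k refinements the norm has lost at most a factor 2^(k DIM), which the volume of
  the level-k cube offsets exactly. Once the Taylor polynomial at the limit point is subtracted, the
  gradient factor \<open>sk k\<close> is offset by the diameter of the cube, of order 1 /
  \<open>sk k\<close>, so the remainder is at most a constant times e at every fine scale.\<close>

lemma integral_spline_pairing_0:
  fixes F F' :: "'a::euclidean_space \<Rightarrow> 'a \<Rightarrow> _" and g :: "'a \<Rightarrow> 'b::euclidean_space"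
  assumes F': "\<And>b y. b \<in> Basis \<Longrightarrow> (F b has_derivative F' b y) (at y)"
    and g: "continuous_on UNIV g" "\<And>y. g y = (\<Sum>b\<in>Basis. F' b y b)"
    and s: "s > 0"
  shows "integral UNIV (spline_pairing F g s t) = 0"
proof -
  define V where "V s t = integral UNIV (spline_pairing F g s t)" for s t
  define cube where "cube s t = cbox (- t /\<^sub>R s) ((3 *\<^sub>R One - t) /\<^sub>R s)" for s and t :: 'a
  have cube_iff: "y \<in> cube s t \<longleftrightarrow> s *\<^sub>R y + t \<in> cbox 0 (3 *\<^sub>R One)" if "s > 0" for s t y
    unfolding cube_def by (rule scaled_cube_iff[OF that])
  have cont: "continuous_on UNIV (F b)" if "b \<in> Basis" for b
    using F'[OF that] by (meson continuous_at_imp_continuous_on has_derivative_continuous)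
  have int: "spline_pairing F g s t integrable_on UNIV" if "s > 0" for s t
  proof (rule integrable_on_UNIV_compact_support)
    show "spline_pairing F g s t y = 0" if "y \<notin> cbox (- t /\<^sub>R s) ((3 *\<^sub>R One - t) /\<^sub>R s)" for y
      using that cube_iff[OF \<open>s > 0\<close>, of y t]
      by (auto simp: spline_pairing_def cube_spline_support cube_def)
  qed (intro continuous_spline_pairing cont g)
  have refine: "V s t = (\<Sum>\<kappa>\<in>grid. grid_weight \<kappa> *\<^sub>R V (2 * s) (2 *\<^sub>R t - grid_vec \<kappa>))" if "s > 0" for s t
    unfolding V_def spline_pairing_refine[of F g s t, abs_def]
    using int[of "2 * s"] that
    by (subst integral_sum) (auto simp: finite_grid intro!: integrable_cmul)
  \<comment> \<open>Pigeonhole: the weights sum to 2^DIM, so if every child fell short of its share,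
    the triangle inequality would make the norm of \<open>V s t\<close> smaller than itself.\<close>
  have step: "\<exists>\<kappa>\<in>grid. norm (V s t) \<le> 2 ^ DIM('a) * norm (V (2 * s) (2 *\<^sub>R t - grid_vec \<kappa>))"
    if "s > 0" for s t
  proof (rule ccontr)
    assume "\<not> ?thesis"
    then have lt: "2 ^ DIM('a) * norm (V (2 * s) (2 *\<^sub>R t - grid_vec \<kappa>)) < norm (V s t)" if "\<kappa> \<in> grid" for \<kappa>
      using that by force
    have "norm (V s t) \<le> (\<Sum>\<kappa>\<in>grid. grid_weight \<kappa> * norm (V (2 * s) (2 *\<^sub>R t - grid_vec \<kappa>)))"
      using norm_sum[of "\<lambda>\<kappa>. grid_weight \<kappa> *\<^sub>R V (2 * s) (2 *\<^sub>R t - grid_vec \<kappa>)" grid]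
      unfolding refine[OF that, of t] by (simp add: grid_weight_nonneg)
    then have "2 ^ DIM('a) * norm (V s t)
        \<le> 2 ^ DIM('a) * (\<Sum>\<kappa>\<in>grid. grid_weight \<kappa> * norm (V (2 * s) (2 *\<^sub>R t - grid_vec \<kappa>)))"
      by (intro mult_left_mono) auto
    also have "\<dots> = (\<Sum>\<kappa>\<in>grid. grid_weight \<kappa> * (2 ^ DIM('a) * norm (V (2 * s) (2 *\<^sub>R t - grid_vec \<kappa>))))"
      by (simp add: sum_distrib_left mult.left_commute)
    also have "\<dots> < (\<Sum>\<kappa>\<in>(grid :: ('a \<Rightarrow> nat) set). grid_weight \<kappa> * norm (V s t))"
    proof (rule sum_strict_mono_ex1)
      show "\<forall>\<kappa>\<in>grid. grid_weight \<kappa> * (2 ^ DIM('a) * norm (V (2 * s) (2 *\<^sub>R t - grid_vec \<kappa>)))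
          \<le> grid_weight \<kappa> * norm (V s t)"
        by (intro ballI mult_left_mono less_imp_le[OF lt] grid_weight_nonneg)
      \<comment> \<open>The strict inequality between the sums needs a child with positive
        weight.\<close>
      have "\<exists>\<kappa>\<in>grid. grid_weight (\<kappa>::'a\<Rightarrow>nat) \<noteq> 0"
      proof (rule ccontr)
        assume "\<not> ?thesis"
        then have "(\<Sum>\<kappa>\<in>grid. grid_weight (\<kappa>::'a\<Rightarrow>nat)) = 0" by (intro sum.neutral) blast
        then show False by (simp add: sum_grid_weight)
      qed
      then obtain \<kappa> :: "'a \<Rightarrow> nat" where "\<kappa> \<in> grid" "grid_weight \<kappa> > 0"
        using grid_weight_nonneg by (metis less_eq_real_def)
      then show "\<exists>\<kappa>\<in>grid. grid_weight \<kappa> * (2 ^ DIM('a) * norm (V (2 * s) (2 *\<^sub>R t - grid_vec \<kappa>)))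
          < grid_weight \<kappa> * norm (V s t)"
        using lt by (intro bexI[of _ \<kappa>]) auto
    qed (rule finite_grid)
    also have "\<dots> = 2 ^ DIM('a) * norm (V s t)"
      by (simp add: sum_grid_weight flip: sum_distrib_right)
    finally show False by simp
  qed
  define sk where "sk k = 2 ^ k * s" for k
  have sk: "sk k > 0" "2 * sk k = sk (Suc k)" for k
    using s by (simp_all add: sk_def)
  have "\<exists>tt. \<forall>k. norm (V s t) \<le> (2 ^ DIM('a)) ^ k * norm (V (sk k) (tt k)) \<and>
      (\<exists>\<kappa>\<in>grid. tt (Suc k) = 2 *\<^sub>R tt k - grid_vec \<kappa>)"
  proof (rule dependent_nat_choice)
    show "\<exists>x. norm (V s t) \<le> (2 ^ DIM('a)) ^ 0 * norm (V (sk 0) x)"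
      by (auto simp: sk_def)
    show "\<exists>y. norm (V s t) \<le> (2 ^ DIM('a)) ^ Suc k * norm (V (sk (Suc k)) y) \<and>
        (\<exists>\<kappa>\<in>grid. y = 2 *\<^sub>R x - grid_vec \<kappa>)"
      if "norm (V s t) \<le> (2 ^ DIM('a)) ^ k * norm (V (sk k) x)" for x k
    proof -
      obtain \<kappa> where \<kappa>: "\<kappa> \<in> grid"
        "norm (V (sk k) x) \<le> 2 ^ DIM('a) * norm (V (sk (Suc k)) (2 *\<^sub>R x - grid_vec \<kappa>))"
        using step[OF sk(1), of k x] by (auto simp: sk(2))
      note that
      also have "(2 ^ DIM('a)) ^ k * norm (V (sk k) x)
          \<le> (2 ^ DIM('a)) ^ k * (2 ^ DIM('a) * norm (V (sk (Suc k)) (2 *\<^sub>R x - grid_vec \<kappa>)))"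
        by (intro mult_left_mono \<kappa>) auto
      finally have "norm (V s t) \<le> (2 ^ DIM('a)) ^ Suc k * norm (V (sk (Suc k)) (2 *\<^sub>R x - grid_vec \<kappa>))"
        by (simp add: mult.assoc mult.left_commute)
      then show ?thesis using \<kappa>(1) by blast
    qed
  qed
  then obtain tt where tt: "\<And>k. norm (V s t) \<le> (2 ^ DIM('a)) ^ k * norm (V (sk k) (tt k))"
      "\<And>k. \<exists>\<kappa>\<in>grid. tt (Suc k) = 2 *\<^sub>R tt k - grid_vec \<kappa>"
    by blast
  define Q where "Q k = cube (sk k) (tt k)" for k
  have Q_iff: "y \<in> Q k \<longleftrightarrow> sk k *\<^sub>R y + tt k \<in> cbox 0 (3 *\<^sub>R One)" for y k
    unfolding Q_def by (rule cube_iff[OF sk(1)])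
  have Q_Suc: "Q (Suc k) \<subseteq> Q k" for k
  proof
    fix y assume y: "y \<in> Q (Suc k)"
    obtain \<kappa> where \<kappa>: "\<kappa> \<in> grid" "tt (Suc k) = 2 *\<^sub>R tt k - grid_vec \<kappa>" using tt(2) by blast
    have "sk (Suc k) *\<^sub>R y = 2 *\<^sub>R (sk k *\<^sub>R y)" by (simp flip: sk(2))
    then have *: "sk (Suc k) *\<^sub>R y + tt (Suc k) = 2 *\<^sub>R (sk k *\<^sub>R y + tt k) - grid_vec \<kappa>"
      by (simp add: \<kappa>(2) algebra_simps)
    \<comment> \<open>For an offset k between 0 and 3, the bounds 0 <= 2u - k <= 3 give 0 <= u <= 3:
      the support of a child lies in that of its parent.\<close>
    have **: "0 \<le> real (\<kappa> c) \<and> real (\<kappa> c) \<le> 3" if "c \<in> Basis" for c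
      using \<kappa>(1) that by (auto simp: grid_def dest!: PiE_mem)
    show "y \<in> Q k"
      unfolding Q_iff mem_box
    proof (intro ballI)
      fix c :: 'a assume c: "c \<in> Basis"
      have "0 \<le> 2 * ((sk k *\<^sub>R y + tt k) \<bullet> c) - real (\<kappa> c)"
        "2 * ((sk k *\<^sub>R y + tt k) \<bullet> c) - real (\<kappa> c) \<le> 3"
        using y c unfolding Q_iff * mem_box
        by (simp_all add: inner_diff_left grid_vec_inner c)
      then show "0 \<bullet> c \<le> (sk k *\<^sub>R y + tt k) \<bullet> c \<and> (sk k *\<^sub>R y + tt k) \<bullet> c \<le> (3 *\<^sub>R One) \<bullet> c"
        using **[OF c] c by simp
    qed
  qed
  have "Q n \<subseteq> Q m" if "m \<le> n" for m n
    by (rule lift_Suc_antimono_le[of Q, OF Q_Suc that])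
  moreover have "compact (Q k)" for k unfolding Q_def cube_def by simp
  moreover have "Q k \<noteq> {}" for k
    using sk(1)[of k] by (auto simp: Q_def cube_def box_ne_empty field_simps inner_simps)
  ultimately have "(\<Inter>k. Q k) \<noteq> {}"
    by (intro compact_nest)
  then obtain p where p: "p \<in> Q k" for k by blast
  have dist: "norm (y - p) \<le> 3 * real DIM('a) / sk k" if "y \<in> Q k" for y k
  proof -
    have "\<bar>(y - p) \<bullet> c\<bar> \<le> 3 / sk k" if "c \<in> Basis" for c
    proof -
      have "0 \<le> sk k * (y \<bullet> c) + tt k \<bullet> c" "sk k * (y \<bullet> c) + tt k \<bullet> c \<le> 3"
        "0 \<le> sk k * (p \<bullet> c) + tt k \<bullet> c" "sk k * (p \<bullet> c) + tt k \<bullet> c \<le> 3"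
        using \<open>y \<in> Q k\<close> p[of k] that unfolding Q_iff mem_box by (auto simp: inner_simps)
      then have "\<bar>sk k * ((y - p) \<bullet> c)\<bar> \<le> 3" by (simp add: algebra_simps inner_diff_left abs_le_iff)
      then show ?thesis using sk(1)[of k] by (simp add: abs_mult field_simps)
    qed
    then have "(\<Sum>c\<in>Basis. \<bar>(y - p) \<bullet> c\<bar>) \<le> (\<Sum>c\<in>(Basis::'a set). 3 / sk k)"
      by (intro sum_mono) auto
    then show ?thesis using norm_le_l1[of "y - p"] by (simp add: mult.commute)
  qed
  obtain M where M: "M \<ge> 0" "\<And>z. \<bar>cube_spline (z::'a)\<bar> \<le> M"
    "\<And>b z. b \<in> Basis \<Longrightarrow> \<bar>cube_spline' b (z::'a)\<bar> \<le> M"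
    using cube_spline_bounded by blast
  \<comment> \<open>Each of the DIM('a) gradient terms is at most 3 DIM('a) M e, the term with
    \<open>g\<close> at most M e, and the level-k cube has volume (3/s)^DIM / 2^(k DIM).\<close>
  define K where "K = (3 * real DIM('a) * real DIM('a) + 1) * M * (3 / s) ^ DIM('a)"
  have K: "K \<ge> 0" unfolding K_def using M(1) s by auto
  have Kb: "norm (V s t) \<le> K * e" if e: "e > 0" for e
  proof -
    define P where "P y \<longleftrightarrow> (\<forall>b\<in>Basis. norm (F b y - F b p - F' b p (y - p)) \<le> e * norm (y - p)) \<and>
      norm (g y - g p) \<le> e" for y
    have "\<forall>\<^sub>F y in nhds p. norm (F b y - F b p - F' b p (y - p)) \<le> e * norm (y - p)" if "b \<in> Basis" for b
      using F'[OF that, of p] e unfolding has_derivative_at_alt eventually_nhds_metric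
      by (auto simp: dist_norm)
    moreover have "\<forall>\<^sub>F y in nhds p. norm (g y - g p) \<le> e"
    proof -
      have "isCont g p" using g(1) continuous_on_eq_continuous_at by blast
      then have "(g \<longlongrightarrow> g p) (nhds p)" unfolding isCont_def tendsto_at_iff_tendsto_nhds .
      then have "\<forall>\<^sub>F y in nhds p. dist (g y) (g p) < e" using e by (rule tendstoD)
      then show ?thesis by eventually_elim (simp add: dist_norm)
    qed
    ultimately have "\<forall>\<^sub>F y in nhds p. P y"
      unfolding P_def by (auto simp: eventually_conj_iff intro!: eventually_ball_finite)
    then obtain d where d: "d > 0" "\<And>y. dist y p < d \<Longrightarrow> P y"
      unfolding eventually_nhds_metric by blast
    obtain k where k: "3 * real DIM('a) / sk k < d"
    proof -
      obtain k where "3 * real DIM('a) / (s * d) < 2 ^ k"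
        using real_arch_pow[of 2] by auto
      then show ?thesis using that[of k] s d(1) by (simp add: sk_def field_simps)
    qed
    have P: "P y" if "y \<in> Q k" for y
      using dist[OF that] k d(2)[of y] by (simp add: dist_norm)
    let ?A = "spline_pairing (\<lambda>b y. F b p + F' b p (y - p)) (\<lambda>_. g p) (sk k) (tt k)"
    let ?R = "spline_pairing (\<lambda>b y. F b y - F b p - F' b p (y - p)) (\<lambda>y. g y - g p) (sk k) (tt k)"
    \<comment> \<open>The equation for \<open>g\<close> at \<open>p\<close> makes the constant
      \<open>g p\<close> the divergence of the affine field.\<close>
    have "(?A has_integral 0) UNIV"
      unfolding g(2)[of p]
      by (rule spline_pairing_affine) (auto intro: has_derivative_linear F' sk)
    with integrable_integral[OF int[OF sk(1)[of k], of "tt k"]]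
    have "((\<lambda>y. spline_pairing F g (sk k) (tt k) y - ?A y) has_integral V (sk k) (tt k) - 0) UNIV"
      unfolding V_def by (rule has_integral_diff)
    moreover have "(\<lambda>y. spline_pairing F g (sk k) (tt k) y - ?A y) = ?R"
      by (rule ext) (simp add: spline_pairing_def algebra_simps sum_subtractf sum.distrib)
    ultimately have R: "(?R has_integral V (sk k) (tt k)) UNIV" by simp
    have R0: "?R y = 0" if "y \<notin> Q k" for y
      using that unfolding Q_iff by (simp add: spline_pairing_def cube_spline_support)
    have "(?R has_integral V (sk k) (tt k)) (Q k)"
    proof -
      have "?R = (\<lambda>y. if y \<in> Q k then ?R y else 0)" by (rule ext) (simp add: R0)
      with R have "((\<lambda>y. if y \<in> Q k then ?R y else 0) has_integral V (sk k) (tt k)) UNIV" by simp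
      then show ?thesis by (simp only: has_integral_restrict_UNIV)
    qed
    then have "norm (V (sk k) (tt k)) \<le> ((3 * real DIM('a) * real DIM('a) + 1) * M * e) *
        measure lborel (cbox (- tt k /\<^sub>R sk k) ((3 *\<^sub>R One - tt k) /\<^sub>R sk k))"
      unfolding Q_def cube_def
    proof (rule has_integral_bound[rotated])
      show "0 \<le> (3 * real DIM('a) * real DIM('a) + 1) * M * e" using M(1) e by simp
      fix y assume "y \<in> cbox (- tt k /\<^sub>R sk k) ((3 *\<^sub>R One - tt k) /\<^sub>R sk k)"
      then have y: "y \<in> Q k" by (simp add: Q_def cube_def)
      have "norm ((sk k * cube_spline' b (sk k *\<^sub>R y + tt k)) *\<^sub>R (F b y - F b p - F' b p (y - p)))
          \<le> 3 * real DIM('a) * M * e" if b: "b \<in> Basis" for b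
      proof -
        have "norm (F b y - F b p - F' b p (y - p)) \<le> e * norm (y - p)"
          using P[OF y] b by (simp add: P_def)
        also have "\<dots> \<le> e * (3 * real DIM('a) / sk k)"
          using dist[OF y] e by (intro mult_left_mono) auto
        finally have "norm ((sk k * cube_spline' b (sk k *\<^sub>R y + tt k)) *\<^sub>R (F b y - F b p - F' b p (y - p)))
            \<le> (sk k * M) * (e * (3 * real DIM('a) / sk k))"
          unfolding norm_scaleR abs_mult using sk(1)[of k] M b
          by (intro mult_mono) auto
        then show ?thesis using sk(1)[of k] by (simp add: mult_ac)
      qed
      then have "norm (\<Sum>b\<in>Basis. (sk k * cube_spline' b (sk k *\<^sub>R y + tt k)) *\<^sub>R (F b y - F b p - F' b p (y - p)))
          \<le> (\<Sum>b\<in>(Basis::'a set). 3 * real DIM('a) * M * e)"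
        by (rule sum_norm_le)
      moreover have "norm (cube_spline (sk k *\<^sub>R y + tt k) *\<^sub>R (g y - g p)) \<le> M * e"
        unfolding norm_scaleR using P[OF y] M by (intro mult_mono) (auto simp: P_def)
      ultimately show "norm (?R y) \<le> (3 * real DIM('a) * real DIM('a) + 1) * M * e"
        unfolding spline_pairing_def by (intro norm_triangle_le) (simp add: algebra_simps)
    qed
    also have "measure lborel (cbox (- tt k /\<^sub>R sk k) ((3 *\<^sub>R One - tt k) /\<^sub>R sk k)) = (3 / sk k) ^ DIM('a)"
      using sk(1)[of k] by (subst content_cbox) (auto simp: inner_simps field_simps divide_simps)
    also have "\<dots> = (3 / s) ^ DIM('a) / (2 ^ DIM('a)) ^ k"
      by (simp add: sk_def power_divide power_mult_distrib mult_ac flip: power_mult)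
    finally have "(2 ^ DIM('a)) ^ k * norm (V (sk k) (tt k)) \<le> (2 ^ DIM('a)) ^ k *
        (((3 * real DIM('a) * real DIM('a) + 1) * M * e) * ((3 / s) ^ DIM('a) / (2 ^ DIM('a)) ^ k))"
      by (rule mult_left_mono) simp
    also have "\<dots> = K * e" by (simp add: K_def)
    finally have "(2 ^ DIM('a)) ^ k * norm (V (sk k) (tt k)) \<le> K * e" .
    with tt(1)[of k] show ?thesis by linarith
  qed
  \<comment> \<open>Dividing by K + 1 rather than K covers the case K = 0.\<close>
  have "norm (V s t) \<le> K * (e / (K + 1))" if "e > 0" for e
    using Kb[of "e / (K + 1)"] K that by simp
  moreover have "K * (e / (K + 1)) \<le> e" if "e > 0" for e
    using K that by (simp add: field_simps)
  ultimately have "norm (V s t) \<le> 0"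
    by (metis field_le_epsilon add_0 order_trans)
  then show ?thesis by (simp add: V_def)
qed

text \<open>As s tends to 0 the bump flattens on the fixed box to the constant
  \<open>cube_spline t0\<close>, while the gradient term carries a factor s. The integrals
  \<open>J s\<close> vanish for s > 0 and depend continuously on s, so \<open>J 0\<close>, a nonzero
  multiple of the integral of \<open>g\<close>, vanishes too.\<close>

lemma integral_divergence_0:
  fixes F F' :: "'a::euclidean_space \<Rightarrow> 'a \<Rightarrow> _" and g :: "'a \<Rightarrow> 'b::euclidean_space"
  assumes F': "\<And>b y. b \<in> Basis \<Longrightarrow> (F b has_derivative F' b y) (at y)"
    and g: "continuous_on UNIV g" "\<And>y. g y = (\<Sum>b\<in>Basis. F' b y b)"
    and supp: "\<And>b y. b \<in> Basis \<Longrightarrow> y \<notin> cbox l r \<Longrightarrow> F b y = 0" "\<And>y. y \<notin> cbox l r \<Longrightarrow> g y = 0"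
  shows "integral (cbox l r) g = 0"
proof -
  define t0 :: 'a where "t0 = (3/2) *\<^sub>R One"
  define J where "J s = integral (cbox l r) (spline_pairing F g s t0)" for s
  have cont: "continuous_on S (F b)" if "b \<in> Basis" for b S
    using F'[OF that] by (meson continuous_at_imp_continuous_on has_derivative_continuous)
  have J: "J s = 0" if "s > 0" for s
  proof -
    have "J s = integral UNIV (spline_pairing F g s t0)"
      unfolding J_def by (rule integral_eq_integral_UNIV) (simp add: spline_pairing_def supp)
    also have "\<dots> = 0" by (rule integral_spline_pairing_0[OF F' g that])
    finally show ?thesis .
  qed
  have "continuous_on UNIV J"
    unfolding J_def spline_pairing_def[abs_def]
  proof (rule integral_continuous_on_param)
    have g': "continuous_on S g" for S using g(1) continuous_on_subset by blast
    show "continuous_on (UNIV \<times> cbox l r) (\<lambda>(s, y). (\<Sum>b\<in>Basis. (s * cube_spline' b (s *\<^sub>R y + t0)) *\<^sub>R F b y)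
      + cube_spline (s *\<^sub>R y + t0) *\<^sub>R g y)"
      unfolding case_prod_unfold
      by (intro continuous_intros continuous_on_compose2[OF continuous_cube_spline(1)[of UNIV]]
          continuous_on_compose2[OF continuous_cube_spline(2)[of UNIV]]
          continuous_on_compose2[OF g'[of UNIV]] continuous_on_compose2[OF cont[of _ UNIV]]) auto
  qed
  then have "(J \<longlongrightarrow> J 0) (at_right 0)"
    by (meson UNIV_I continuous_on_def tendsto_within_subset subset_UNIV)
  moreover have "(J \<longlongrightarrow> 0) (at_right 0)"
    by (rule tendsto_eventually) (auto simp: J eventually_at_right_less intro: eventually_at_rightI[of 0 1])
  ultimately have "J 0 = 0"
    using tendsto_unique trivial_limit_at_right_real by blast
  moreover have "J 0 = cube_spline t0 *\<^sub>R integral (cbox l r) g"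
    unfolding J_def spline_pairing_def[abs_def] by simp
  ultimately show ?thesis using cube_spline_center_nonzero[where 'a='a] by (simp add: t0_def)
qed

section \<open>Paravectors and Vahlen matrices\<close>

lemma linear_cl_of: "linear (cl_of :: 'n::{finite,linorder} paravector \<Rightarrow> _)"
  by (rule linearI)
    (simp_all add: cl_of_def of_real_def algebra_simps sum.distrib scaleR_sum_right)

lemma cl_of_scalar: "cl_of (r, 0) = of_real r"
  by (simp add: cl_of_def)

lemma cl_of_e [simp]: "cl_of e_zero = 1" "cl_of (e_vec i) = cl_gen i"
proof -
  show "cl_of e_zero = 1" by (simp add: cl_of_def e_zero_def)
  have "(\<Sum>j\<in>UNIV. (axis i 1 $ j) *\<^sub>R cl_gen j) = (\<Sum>j\<in>UNIV. if j = i then cl_gen i else 0)"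
    by (intro sum.cong) (auto simp: axis_def)
  then show "cl_of (e_vec i) = cl_gen i" by (simp add: cl_of_def e_vec_def)
qed

definition pv_conj :: "'n::{finite,linorder} paravector \<Rightarrow> 'n paravector" where
  "pv_conj v = (fst v, - snd v)"

lemma pv_conj_conj [simp]: "pv_conj (pv_conj v) = v"
  by (simp add: pv_conj_def)

lemma norm_pv_conj [simp]: "norm (pv_conj v) = norm v"
  by (simp add: pv_conj_def norm_prod_def)

lemma last_coord_simps [simp]:
  "last_coord (u + v) = last_coord u + last_coord v"
  "last_coord (u - v) = last_coord u - last_coord v"
  "last_coord (- v) = - last_coord v"
  "last_coord (r *\<^sub>R v) = r * last_coord v"
  "last_coord (pv_conj v) = - last_coord v"
  "last_coord (r, 0) = 0"
  "last_coord 0 = 0"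
  by (simp_all add: last_coord_def pv_conj_def)

lemma involution_cl_of:
  "conjugation (cl_of v) = cl_of (pv_conj v)"
  "reversion (cl_of v) = cl_of v"
proof -
  have "conjugation (of_real r) = of_real r" "reversion (of_real r) = of_real r" for r
    using linear_scale[OF linear_involutions(1), of r 1] linear_scale[OF linear_involutions(2), of r 1]
    by (simp_all add: of_real_def involutions_one)
  then show "conjugation (cl_of v) = cl_of (pv_conj v)" "reversion (cl_of v) = cl_of v"
    by (simp_all add: cl_of_def pv_conj_def linear_add[OF linear_involutions(1)]
        linear_add[OF linear_involutions(2)] linear_sum[OF linear_involutions(1)]
        linear_sum[OF linear_involutions(2)] linear_scale[OF linear_involutions(1)]
        linear_scale[OF linear_involutions(2)] involutions_gen sum_negf)
qed

text \<open>The vector parts satisfy S v S w + S w S v = -2 <v, w> by the Clifford relations, and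
  the mixed products of scalar and vector parts cancel because of the conjugations.\<close>

lemma cl_of_polar: "conjugation (cl_of v) * cl_of w + conjugation (cl_of w) * cl_of v = of_real (2 * inner v w)"
proof -
  define S where "S u = (\<Sum>i\<in>UNIV. (snd u $ i) *\<^sub>R cl_gen i)" for u :: "'a paravector"
  have "S v * S w + S w * S v = (\<Sum>i\<in>UNIV. \<Sum>j\<in>UNIV. (snd v $ i * snd w $ j) *\<^sub>R (cl_gen i * cl_gen j + cl_gen j * cl_gen i))"
  proof -
    have "S w * S v = (\<Sum>i\<in>UNIV. \<Sum>j\<in>UNIV. (snd v $ i * snd w $ j) *\<^sub>R (cl_gen j * cl_gen i))"
      unfolding S_def sum_distrib_left sum_distrib_right by (subst sum.swap) (simp add: mult.commute, rule sum.swap)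
    moreover have "S v * S w = (\<Sum>i\<in>UNIV. \<Sum>j\<in>UNIV. (snd v $ i * snd w $ j) *\<^sub>R (cl_gen i * cl_gen j))"
      unfolding S_def sum_distrib_left sum_distrib_right
      by (simp add: mult.commute, rule sum.swap)
    ultimately show ?thesis by (simp add: sum.distrib scaleR_add_right)
  qed
  also have "\<dots> = (\<Sum>i\<in>UNIV. of_real (-2 * (snd v $ i * snd w $ i)))"
  proof (rule sum.cong[OF refl])
    fix i :: 'a
    have "(\<Sum>j\<in>UNIV. (snd v $ i * snd w $ j) *\<^sub>R (cl_gen i * cl_gen j + cl_gen j * cl_gen i))
        = (\<Sum>j\<in>UNIV. if i = j then of_real (-2 * (snd v $ i * snd w $ i)) else (0 :: 'a clifford))"
      by (intro sum.cong refl) (auto simp: cl_gen_anticommute of_real_def)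
    then show "(\<Sum>j\<in>UNIV. (snd v $ i * snd w $ j) *\<^sub>R (cl_gen i * cl_gen j + cl_gen j * cl_gen i))
        = of_real (-2 * (snd v $ i * snd w $ i))" by simp
  qed
  finally have anti: "S v * S w + S w * S v = of_real (-2 * inner (snd v) (snd w))"
    by (simp add: inner_vec_def sum_distrib_left sum_negf)
  have *: "cl_of u = of_real (fst u) + S u" "cl_of (pv_conj u) = of_real (fst u) - S u" for u
    by (simp_all add: cl_of_def S_def pv_conj_def sum_negf)
  have "conjugation (cl_of v) * cl_of w + conjugation (cl_of w) * cl_of v
      = of_real (2 * (fst v * fst w)) - (S v * S w + S w * S v)"
    unfolding involution_cl_of unfolding *(2) unfolding *(1)
    by (simp add: algebra_simps of_real_def flip: scaleR_add_left)
  then show ?thesis unfolding anti by (simp add: inner_prod_def flip: of_real_diff)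
qed

lemma conjugation_cl_of_mult: "conjugation (cl_of v) * cl_of v = of_real ((norm v)\<^sup>2)"
proof -
  have "2 *\<^sub>R (conjugation (cl_of v) * cl_of v) = 2 *\<^sub>R of_real ((norm v)\<^sup>2)"
    using cl_of_polar[of v v] by (simp add: scaleR_2 power2_norm_eq_inner flip: of_real_add)
  then show ?thesis by (subst (asm) scaleR_cancel_left) simp
qed

lemma cl_of_mult_conjugation: "cl_of v * conjugation (cl_of v) = of_real ((norm v)\<^sup>2)"
  using conjugation_cl_of_mult[of "pv_conj v"] by (simp add: involution_cl_of)

text \<open>The sign of conj(e_A) and that of e_A e_A are both \<open>cl_sign A A\<close> and
  cancel, and conj(e_A) e_B has a scalar part only for A = B. This makes the Euclidean norm
  accessible to algebra.\<close>

lemma cl_coeff_conjugation_mult: "cl_coeff (conjugation x * y) {} = inner x (y :: 'n::{finite,linorder} clifford)"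
proof -
  have "cl_coeff (conjugation x * y) {} = (\<Sum>A\<in>UNIV. \<Sum>B\<in>UNIV.
      if A = B then cl_sign A A * cl_coeff x A * cl_coeff y A * cl_sign A A else 0)"
    unfolding times_clifford_def cl_coeff_sum
    by (intro sum.cong refl) (auto simp: conjugation_def conjugation_sign[symmetric])
  also have "\<dots> = (\<Sum>A\<in>UNIV. (cl_sign A A * cl_sign A A) * (cl_coeff x A * cl_coeff y A))"
    by (simp add: mult_ac)
  finally show ?thesis by (simp add: cl_sign_square inner_clifford_def)
qed

text \<open>The Euclidean norm is not multiplicative on the algebra in general. A scalar conj(u) u,
  however, can be pulled out of conj(z) conj(u) u z, so left multiplication by \<open>u\<close> is a
  multiple of an isometry.\<close>

lemma norm_mult_of_conjugation:
  assumes "conjugation u * u = of_real r"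
  shows "r = (norm u)\<^sup>2" and "norm (u * z) = norm u * norm (z :: 'n::{finite,linorder} clifford)"
proof -
  have "inner (u * z) (u * z) = r * inner z z" for z
  proof -
    have "conjugation (u * z) * (u * z) = conjugation z * (conjugation u * u) * z"
      by (simp add: conjugation_mult mult.assoc)
    also have "\<dots> = r *\<^sub>R (conjugation z * z)" by (simp add: assms of_real_def)
    finally show ?thesis by (simp flip: cl_coeff_conjugation_mult)
  qed
  from this[of 1] this[of z] have 1: "inner u u = r * inner (1 :: 'n clifford) 1" and 2: "inner (u * z) (u * z) = r * inner z z"
    by simp_all
  have "inner (1 :: 'n clifford) 1 = 1"
    unfolding cl_coeff_conjugation_mult[symmetric] by (simp add: involutions_one) (simp add: one_clifford_def)
  with 1 show r: "r = (norm u)\<^sup>2" by (simp add: power2_norm_eq_inner)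
  have "(norm (u * z))\<^sup>2 = (norm u * norm z)\<^sup>2"
    using 2 by (simp add: power2_norm_eq_inner power_mult_distrib flip: r)
      (simp add: r power2_norm_eq_inner)
  then show "norm (u * z) = norm u * norm z"
    by (simp add: power2_eq_iff_nonneg)
qed

lemma norm_cl_of [simp]: "norm (cl_of v) = norm v"
  using norm_mult_of_conjugation(1)[OF conjugation_cl_of_mult[of v]] by simp

lemma clifford_inverse_eqI:
  fixes x y :: "'n::{finite,linorder} clifford"
  assumes "x * y = 1" "y * x = 1"
  shows "inverse x = y"
proof -
  have u: "z = y" if "x * z = 1 \<and> z * x = 1" for z
    using that assms by (metis mult.assoc mult.left_neutral mult.right_neutral)
  have "(THE z. x * z = 1 \<and> z * x = 1) = y"
    by (rule the_equality) (simp add: assms, rule u)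
  moreover have "\<exists>z. x * z = 1 \<and> z * x = 1" using assms by blast
  ultimately show ?thesis unfolding inverse_clifford_def by (simp only: if_True)
qed

lemma cl_of_inverse:
  assumes "v \<noteq> 0"
  shows "cl_of v * cl_of (pv_conj v /\<^sub>R (norm v)\<^sup>2) = 1" "cl_of (pv_conj v /\<^sub>R (norm v)\<^sup>2) * cl_of v = 1"
  using assms conjugation_cl_of_mult[of v] cl_of_mult_conjugation[of v]
  by (simp_all add: linear_scale[OF linear_cl_of] involution_cl_of of_real_def)

text \<open>The products that occur for p = n - 1, which include those for every smaller p.
  Coordinate pairs are used so that norms and last coordinates of the factors are directly
  available.\<close>

definition boundary_products :: "'n::{finite,linorder} clifford set" where
  "boundary_products = {prod_list (map cl_of vs) | vs. \<forall>v\<in>set vs. last_coord v = 0}"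

lemma boundary_products_induct [consumes 1, case_names one mult]:
  assumes "u \<in> boundary_products" "P 1"
    "\<And>v u. last_coord v = 0 \<Longrightarrow> u \<in> boundary_products \<Longrightarrow> P u \<Longrightarrow> P (cl_of v * u)"
  shows "P u"
proof -
  obtain vs where vs: "u = prod_list (map cl_of vs)" "\<forall>v\<in>set vs. last_coord v = 0"
    using assms(1) by (auto simp: boundary_products_def)
  have "P (prod_list (map cl_of vs))" using vs(2)
  proof (induction vs)
    case (Cons v vs)
    then have "prod_list (map cl_of vs) \<in> boundary_products" by (auto simp: boundary_products_def)
    with Cons show ?case by (auto intro: assms(3))
  qed (simp add: assms(2))
  then show ?thesis using vs(1) by simp
qed

lemma one_in_boundary_products: "1 \<in> boundary_products"
  unfolding boundary_products_def by (auto intro!: exI[of _ "[]"])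

lemma cl_of_in_boundary_products: "last_coord v = 0 \<Longrightarrow> cl_of v \<in> boundary_products"
  unfolding boundary_products_def by (auto intro!: exI[of _ "[v]"])

lemma mult_in_boundary_products:
  assumes "u \<in> boundary_products" "w \<in> boundary_products"
  shows "u * w \<in> boundary_products"
proof -
  obtain us ws where "u = prod_list (map cl_of us)" "\<forall>v\<in>set us. last_coord v = 0"
    "w = prod_list (map cl_of ws)" "\<forall>v\<in>set ws. last_coord v = 0"
    using assms by (auto simp: boundary_products_def)
  then show ?thesis unfolding boundary_products_def by (auto intro!: exI[of _ "us @ ws"])
qed

lemma conjugation_in_boundary_products:
  "u \<in> boundary_products \<Longrightarrow> conjugation u \<in> boundary_products"
  by (induction rule: boundary_products_induct)
    (auto simp: involutions_one conjugation_mult involution_cl_of one_in_boundary_products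
      intro!: mult_in_boundary_products cl_of_in_boundary_products)

text \<open>In either order the innermost product is real, hence central, and can be pulled out; by
  induction both orders give the same real number.\<close>

lemma boundary_products_norm:
  assumes "u \<in> boundary_products"
  shows "conjugation u * u = of_real ((norm u)\<^sup>2)" "u * conjugation u = of_real ((norm u)\<^sup>2)"
proof -
  have "\<exists>r. conjugation u * u = of_real r \<and> u * conjugation u = of_real r"
    using assms
  proof (induction rule: boundary_products_induct)
    case one
    then show ?case by (intro exI[of _ 1]) (simp add: involutions_one)
  next
    case (mult v u)
    then obtain r where r: "conjugation u * u = of_real r" "u * conjugation u = of_real r" by blast
    have "conjugation (cl_of v * u) * (cl_of v * u) = conjugation u * (conjugation (cl_of v) * cl_of v) * u"
      "(cl_of v * u) * conjugation (cl_of v * u) = cl_of v * (u * conjugation u) * conjugation (cl_of v)"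
      by (simp_all add: conjugation_mult mult.assoc)
    then show ?case
      by (intro exI[of _ "(norm v)\<^sup>2 * r"])
        (simp only: conjugation_cl_of_mult cl_of_mult_conjugation r,
          simp add: of_real_def r[unfolded of_real_def] conjugation_cl_of_mult[unfolded of_real_def]
          cl_of_mult_conjugation[unfolded of_real_def] mult.commute)
  qed
  then show "conjugation u * u = of_real ((norm u)\<^sup>2)" "u * conjugation u = of_real ((norm u)\<^sup>2)"
    using norm_mult_of_conjugation(1) by metis+
qed

lemma boundary_products_inverse:
  assumes "u \<in> boundary_products" "u \<noteq> 0"
  shows "u * inverse u = 1" "inverse u * u = 1" "inverse u \<in> boundary_products"
    "norm (inverse u) = 1 / norm u"
proof -
  let ?w = "conjugation u /\<^sub>R (norm u)\<^sup>2"
  have w: "u * ?w = 1" "?w * u = 1"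
    using assms(2) by (simp_all add: boundary_products_norm[OF assms(1)] of_real_def)
  then have i: "inverse u = ?w" by (rule clifford_inverse_eqI)
  show *: "u * inverse u = 1" and "inverse u * u = 1" using w by (simp_all add: i)
  \<comment> \<open>The scalar 1/|u|^2 is itself a paravector with vanishing last coordinate, so the
    inverse is again a product of the required kind.\<close>
  have "?w = cl_of (1 / (norm u)\<^sup>2, 0) * conjugation u"
    by (simp add: cl_of_scalar of_real_def field_simps)
  then show "inverse u \<in> boundary_products"
    unfolding i using assms(1)
    by (auto intro!: mult_in_boundary_products cl_of_in_boundary_products conjugation_in_boundary_products)
  have "norm (u * inverse u) = norm u * norm (inverse u)"
    by (rule norm_mult_of_conjugation(2)[OF boundary_products_norm(1)[OF assms(1)]])
  moreover have "norm (1 :: 'a clifford) = 1"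
    using norm_cl_of[of "(1, 0) :: 'a paravector"] by (simp add: cl_of_scalar norm_prod_def)
  ultimately show "norm (inverse u) = 1 / norm u"
    using assms(2) by (simp add: * field_simps)
qed

text \<open>For a paravector $v$ one has $v y v = 2 \langle \bar v, y\rangle v - |v|^2 \bar y$, so a factor
  $v$ with vanishing last coordinate scales the last coordinate of $y$ by $|v|^2$.\<close>

lemma boundary_products_sandwich:
  assumes "u \<in> boundary_products"
  obtains y' where "reversion u * cl_of y * u = cl_of y'" "last_coord y' = (norm u)\<^sup>2 * last_coord y"
proof -
  have "\<exists>y'. reversion u * cl_of y * u = cl_of y' \<and> last_coord y' = (norm u)\<^sup>2 * last_coord y"
    using assms
  proof (induction arbitrary: y rule: boundary_products_induct)
    case one
    have "norm (1 :: 'a clifford) = 1"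
      using norm_cl_of[of "(1, 0) :: 'a paravector"] by (simp add: cl_of_scalar norm_prod_def)
    then show ?case by (intro exI[of _ y]) (simp add: involutions_one)
  next
    case (mult v u)
    define y1 where "y1 = (2 * inner (pv_conj v) y) *\<^sub>R v - (norm v)\<^sup>2 *\<^sub>R pv_conj y"
    have "cl_of v * cl_of y = of_real (2 * inner (pv_conj v) y) - cl_of (pv_conj y) * cl_of (pv_conj v)"
      using cl_of_polar[of "pv_conj v" y] by (simp add: involution_cl_of eq_diff_eq)
    then have "cl_of v * cl_of y * cl_of v
        = of_real (2 * inner (pv_conj v) y) * cl_of v - cl_of (pv_conj y) * (cl_of (pv_conj v) * cl_of v)"
      by (simp add: left_diff_distrib mult.assoc)
    also have "\<dots> = cl_of y1"
      using conjugation_cl_of_mult[of v]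
      by (simp add: y1_def involution_cl_of linear_diff[OF linear_cl_of] linear_scale[OF linear_cl_of] of_real_def)
    finally have 1: "cl_of v * cl_of y * cl_of v = cl_of y1" .
    have 2: "last_coord y1 = (norm v)\<^sup>2 * last_coord y"
      using mult by (simp add: y1_def)
    obtain y' where y': "reversion u * cl_of y1 * u = cl_of y'" "last_coord y' = (norm u)\<^sup>2 * last_coord y1"
      using mult by blast
    have "reversion (cl_of v * u) * cl_of y * (cl_of v * u) = reversion u * (cl_of v * cl_of y * cl_of v) * u"
      by (simp add: reversion_mult involution_cl_of mult.assoc)
    moreover have "norm (cl_of v * u) = norm v * norm u"
      using norm_mult_of_conjugation(2)[OF conjugation_cl_of_mult] by simp
    ultimately show ?case
      using y' 2 by (intro exI[of _ y']) (simp add: 1 power_mult_distrib)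
  qed
  then show ?thesis using that by blast
qed

text \<open>The index of e_n is \<open>Max UNIV\<close>, whose initial segment has n elements. As n
  >= 1, the natural-number bound p <= n - 1 means p < n, so the coordinate at that index
  vanishes.\<close>

lemma paravectors_boundary:
  fixes x :: "'n::{finite,linorder} clifford"
  assumes "p \<le> CARD('n) - 1" "x \<in> paravectors p"
  obtains v where "x = cl_of v" "last_coord v = 0"
proof -
  obtain v where v: "x = cl_of v" "\<forall>i. p < card {..i} \<longrightarrow> snd v $ i = 0"
    using assms(2) by (auto simp: paravectors_def)
  have "{..Max UNIV} = (UNIV :: 'n set)" by auto
  moreover have "p < CARD('n)"
    using assms(1) zero_less_card_finite[where 'a='n] by linarith
  ultimately have "last_coord v = 0" using v(2) by (simp add: last_coord_def)
  with v(1) show ?thesis by (rule that)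
qed

lemma paravector_products_boundary:
  fixes x :: "'n::{finite,linorder} clifford"
  assumes "p \<le> CARD('n) - 1" "x \<in> paravector_products p"
  shows "x \<in> boundary_products"
proof -
  obtain ws where ws: "x = prod_list ws" "set ws \<subseteq> paravectors p"
    using assms(2) by (auto simp: paravector_products_def)
  have "prod_list ws \<in> boundary_products" using ws(2)
  proof (induction ws)
    case (Cons w ws)
    then show ?case
      by (auto intro!: mult_in_boundary_products cl_of_in_boundary_products elim!: paravectors_boundary[OF assms(1)])
  qed (simp add: one_in_boundary_products)
  with ws show ?thesis by simp
qed

text \<open>For c = 0 the image is rev(d)^(-1) (x + r) d^(-1) with b = a r. For c \<noteq> 0 it is a
  c^(-1) - rev(c)^(-1) z^(-1) c^(-1) with z = x + c^(-1) d: the first summand has last coordinate 0,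
  the second is a sandwich of z^(-1), and inverting a paravector reverses the sign of its last
  coordinate, which makes up for the minus.\<close>

lemma moebius_upper_half_space:
  fixes x :: "'n::{finite,linorder} paravector"
  assumes p: "p \<le> CARD('n) - 1" and M: "M \<in> SAV p" and x: "x \<in> upper_half_space"
  shows "cocycle M x \<noteq> 0" "last_coord (moebius M x) = last_coord x / (norm (cocycle M x))\<^sup>2"
proof -
  define a b c d where "a = M $ 1 $ 1" and "b = M $ 1 $ 2" and "c = M $ 2 $ 1" and "d = M $ 2 $ 2"
  have prods: "a \<in> boundary_products" "c \<in> boundary_products" "d \<in> boundary_products"
    and det: "a * reversion d - b * reversion c = 1"
    and ab: "a \<noteq> 0 \<Longrightarrow> inverse a * b \<in> paravectors p"
    and cd: "c \<noteq> 0 \<Longrightarrow> inverse c * d \<in> paravectors p"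
    using M paravector_products_boundary[OF p]
    unfolding SAV_def a_def b_def c_def d_def by (auto simp: Let_def)
  have rev0: "reversion (0 :: 'n clifford) = 0"
    using linear_0[OF linear_involutions(2)] .
  have b_eq: "\<exists>r. b = a * cl_of r \<and> last_coord r = 0" if "a \<noteq> 0"
  proof -
    have "inverse a * b \<in> paravectors p" by (rule ab[OF that])
    then obtain r where r: "inverse a * b = cl_of r" "last_coord r = 0"
      using paravectors_boundary[OF p] by blast
    have "b = a * inverse a * b" using boundary_products_inverse(1)[OF prods(1) that] by simp
    with r show ?thesis by (intro exI[of _ r]) (simp add: mult.assoc)
  qed
  have rev_inv: "reversion (inverse u) * reversion u = 1" "reversion u * reversion (inverse u) = 1"
    if "u \<in> boundary_products" "u \<noteq> 0" for u :: "'n clifford"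
    using boundary_products_inverse(1,2)[OF that] by (metis reversion_mult involutions_one(2))+
  have coc: "cocycle M x = c * cl_of x + d" by (simp add: cocycle_def c_def d_def)
  have "\<exists>y. (a * cl_of x + b) * inverse (cocycle M x) = cl_of y \<and> cocycle M x \<noteq> 0 \<and>
      last_coord y = last_coord x / (norm (cocycle M x))\<^sup>2"
  proof (cases "c = 0")
    case True
    then have ad: "a * reversion d = 1" using det by (simp add: rev0)
    then have "a \<noteq> 0" "d \<noteq> 0" by (auto simp: rev0)
    obtain r where r: "b = a * cl_of r" "last_coord r = 0" using b_eq[OF \<open>a \<noteq> 0\<close>] by blast
    have "a = a * (reversion d * reversion (inverse d))"
      using rev_inv(2)[OF prods(3) \<open>d \<noteq> 0\<close>] by simp
    then have a: "a = reversion (inverse d)" using ad by (simp flip: mult.assoc)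
    obtain y where y: "reversion (inverse d) * cl_of (x + r) * inverse d = cl_of y"
      "last_coord y = (norm (inverse d))\<^sup>2 * last_coord (x + r)"
      using boundary_products_sandwich[OF boundary_products_inverse(3)[OF prods(3) \<open>d \<noteq> 0\<close>]] by blast
    have "(a * cl_of x + b) * inverse (cocycle M x) = cl_of y"
      using y(1) by (simp add: r(1) coc True linear_add[OF linear_cl_of] distrib_left distrib_right flip: a)
    moreover have "last_coord y = last_coord x / (norm (cocycle M x))\<^sup>2"
      using y(2) r(2) by (simp add: boundary_products_inverse(4)[OF prods(3) \<open>d \<noteq> 0\<close>] coc True power_divide)
    ultimately show ?thesis using \<open>d \<noteq> 0\<close> by (intro exI[of _ y]) (simp add: coc True)
  next
    case False
    note inv_c = boundary_products_inverse[OF prods(2) False]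
    obtain q where q: "inverse c * d = cl_of q" "last_coord q = 0"
      using paravectors_boundary[OF p cd[OF False]] by blast
    have d: "d = c * cl_of q"
      using q(1) inv_c(1) by (metis mult.assoc mult.left_neutral)
    define z where "z = x + q"
    have last_z: "last_coord z = last_coord x" by (simp add: z_def q(2))
    then have "z \<noteq> 0" using x by (auto simp: upper_half_space_def)
    define zi where "zi = pv_conj z /\<^sub>R (norm z)\<^sup>2"
    note zi = cl_of_inverse[OF \<open>z \<noteq> 0\<close>, folded zi_def]
    have coc': "cocycle M x = c * cl_of z"
      by (simp add: coc d z_def linear_add[OF linear_cl_of] distrib_left)
    have norm_coc: "norm (cocycle M x) = norm c * norm z"
      unfolding coc' using norm_mult_of_conjugation(2)[OF boundary_products_norm(1)[OF prods(2)]] by simp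
    have inv_coc: "inverse (cocycle M x) = cl_of zi * inverse c"
    proof (rule clifford_inverse_eqI)
      have "c * cl_of z * (cl_of zi * inverse c) = c * (cl_of z * cl_of zi) * inverse c"
        "cl_of zi * inverse c * (c * cl_of z) = cl_of zi * (inverse c * c) * cl_of z"
        by (simp_all add: mult.assoc)
      then show "cocycle M x * (cl_of zi * inverse c) = 1" "cl_of zi * inverse c * cocycle M x = 1"
        by (simp_all add: coc' zi inv_c)
    qed
    \<comment> \<open>Since d = c q, its reversion is q rev(c), so the determinant condition
      factors.\<close>
    have "(a * cl_of q - b) * reversion c = 1"
      using det by (simp add: d reversion_mult involution_cl_of left_diff_distrib mult.assoc)
    then have "(a * cl_of q - b) * (reversion c * reversion (inverse c)) = reversion (inverse c)"
      by (simp flip: mult.assoc)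
    then have aqb: "a * cl_of q - b = reversion (inverse c)"
      using rev_inv(2)[OF prods(2) False] by simp
    \<comment> \<open>If a \<noteq> 0, then b = a r gives a (q - r) = rev(c)^(-1), so a c^(-1) is
      the sandwich of (q - r)^(-1) by c^(-1), and q - r has last coordinate 0.\<close>
    have "\<exists>y2. a * inverse c = cl_of y2 \<and> last_coord y2 = 0"
    proof (cases "a = 0")
      case True
      then show ?thesis by (intro exI[of _ 0]) (simp add: linear_0[OF linear_cl_of])
    next
      case a0: False
      obtain r where r: "b = a * cl_of r" "last_coord r = 0" using b_eq[OF a0] by blast
      have aqr: "a * cl_of (q - r) = reversion (inverse c)"
        using aqb by (simp add: r linear_diff[OF linear_cl_of] right_diff_distrib)
      have "reversion (inverse c) \<noteq> 0" using rev_inv(1)[OF prods(2) False] by auto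
      then have "q - r \<noteq> 0" using aqr linear_0[OF linear_cl_of] by (metis mult_zero_right)
      note qr = cl_of_inverse(1)[OF this]
      define k where "k = pv_conj (q - r) /\<^sub>R (norm (q - r))\<^sup>2"
      have "last_coord k = 0" by (simp add: k_def q(2) r(2))
      have "a = a * cl_of (q - r) * cl_of k"
        using qr by (simp add: k_def mult.assoc)
      then have "a * inverse c = reversion (inverse c) * cl_of k * inverse c"
        by (simp add: aqr)
      then show ?thesis
        using boundary_products_sandwich[OF inv_c(3), of k] \<open>last_coord k = 0\<close> by (metis mult_zero_right)
    qed
    then obtain y2 where y2: "a * inverse c = cl_of y2" "last_coord y2 = 0" by blast
    obtain y1 where y1: "reversion (inverse c) * cl_of zi * inverse c = cl_of y1"
      "last_coord y1 = (norm (inverse c))\<^sup>2 * last_coord zi"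
      using boundary_products_sandwich[OF inv_c(3)] by blast
    have "a * cl_of x + b = a * cl_of z - reversion (inverse c)"
      by (simp add: z_def linear_add[OF linear_cl_of] distrib_left flip: aqb)
    then have "(a * cl_of x + b) * inverse (cocycle M x)
        = a * (cl_of z * cl_of zi) * inverse c - reversion (inverse c) * cl_of zi * inverse c"
      by (simp add: inv_coc left_diff_distrib mult.assoc)
    then have "(a * cl_of x + b) * inverse (cocycle M x) = cl_of (y2 - y1)"
      by (simp add: zi y1 y2 linear_diff[OF linear_cl_of])
    moreover have "last_coord (y2 - y1) = last_coord x / (norm (cocycle M x))\<^sup>2"
      by (simp add: y1 y2 norm_coc inv_c(4) zi_def last_z power_mult_distrib power_divide divide_simps)
    moreover have "cocycle M x \<noteq> 0"
      using norm_coc False \<open>z \<noteq> 0\<close> by (metis mult_eq_0_iff norm_eq_zero)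
    ultimately show ?thesis by blast
  qed
  then obtain y where y: "(a * cl_of x + b) * inverse (cocycle M x) = cl_of y" "cocycle M x \<noteq> 0"
      "last_coord y = last_coord x / (norm (cocycle M x))\<^sup>2"
    by blast
  have "moebius M x = y"
    using y(1) by (simp add: moebius_def a_def b_def inv_f_f[OF inj_cl_of])
  with y show "cocycle M x \<noteq> 0" "last_coord (moebius M x) = last_coord x / (norm (cocycle M x))\<^sup>2"
    by simp_all
qed

section \<open>Mean value property\<close>

text \<open>A truncated polynomial in |y|^2, hence without singularity at the origin. For k >= 1 and
  r > 0 it is supported in the ball of radius r and of class C^(k-1).\<close>

definition rad :: "nat \<Rightarrow> real \<Rightarrow> 'a::euclidean_space \<Rightarrow> real" where
  "rad k r y = max 0 (1 - inner y y / r\<^sup>2) ^ k"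

lemma continuous_rad: "continuous_on S (rad k r)"
  unfolding rad_def[abs_def] by (cases "r = 0") (auto intro!: continuous_intros)

text \<open>The exponent is a successor because \<open>0 ^ 0 = 1\<close>: with exponent 0 the kernel
  would be 1 outside the ball.\<close>

lemma rad_outside: "rad (Suc k) r y = 0" if "r > 0" "norm y \<ge> r"
proof -
  have "r\<^sup>2 \<le> inner y y" using that by (simp flip: power2_norm_eq_inner)
  then have "1 - inner y y / r\<^sup>2 \<le> 0" using that by simp
  then show ?thesis by (simp add: rad_def max_def)
qed

lemma has_derivative_rad:
  "(rad (n + 2) r has_derivative (\<lambda>v. (- real (n + 2) * 2 / r\<^sup>2) * (rad (n + 1) r y * inner y v))) (at y)"
proof -
  have "((\<lambda>y. 1 - inner y y / r\<^sup>2) has_derivative (\<lambda>v. - 2 * inner y v / r\<^sup>2)) (at y)"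
  proof -
    have "((\<lambda>y. inner y y) has_derivative (\<lambda>v. inner y v + inner v y)) (at y)"
      by (intro has_derivative_inner has_derivative_ident)
    then have "((\<lambda>y. 1 - (1 / r\<^sup>2) * inner y y) has_derivative (\<lambda>v. 0 - (1 / r\<^sup>2) * (inner y v + inner v y))) (at y)"
      by (intro has_derivative_diff has_derivative_const has_derivative_mult_right)
    then show ?thesis by (simp add: inner_commute[of _ y])
  qed
  from has_derivative_compose[OF this has_real_derivative_max_power[unfolded has_field_derivative_def, of n]]
  show ?thesis
    unfolding rad_def[abs_def] by (rule has_derivative_eq_rhs) (auto simp add: fun_eq_iff algebra_simps divide_inverse)
qed

text \<open>Where \<open>x + y\<close> leaves \<open>S\<close> the kernel already vanishes, so two
  open sets on which the product is visibly continuous cover the space.\<close>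

lemma continuous_on_compact_support_scaleR:
  fixes f :: "'a::euclidean_space \<Rightarrow> 'b::real_normed_vector"
  assumes "continuous_on UNIV k" "\<And>y. norm y > r \<Longrightarrow> k y = 0"
    and "open S" "continuous_on S f" "cball x r \<subseteq> S"
  shows "continuous_on UNIV (\<lambda>y. k y *\<^sub>R f (x + y))"
proof -
  let ?S = "(\<lambda>y. x + y) -` S"
  have "continuous_on (?S \<union> - cball 0 r) (\<lambda>y. k y *\<^sub>R f (x + y))"
  proof (rule continuous_on_open_Un)
    show "open ?S" by (intro open_vimage assms continuous_intros)
    show "continuous_on ?S (\<lambda>y. k y *\<^sub>R f (x + y))"
      by (intro continuous_intros continuous_on_subset[OF assms(1)] continuous_on_compose2[OF assms(4)]) auto
    show "continuous_on (- cball 0 r) (\<lambda>y. k y *\<^sub>R f (x + y))"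
      by (rule continuous_on_eq[OF continuous_on_const[of _ 0]]) (auto simp: assms(2))
  qed (auto simp: open_Compl)
  moreover have "?S \<union> - cball 0 r = UNIV"
    using assms(5) by (auto simp: subset_iff dist_norm)
  ultimately show ?thesis by simp
qed

lemma cball_subset_cube: "cball 0 r \<subseteq> cbox (- (r *\<^sub>R One)) (r *\<^sub>R (One :: 'a::euclidean_space))"
proof
  fix y :: 'a assume "y \<in> cball 0 r"
  then have "\<bar>inner y b\<bar> \<le> r" if "b \<in> Basis" for b
    using Basis_le_norm[OF that, of y] by simp
  then show "y \<in> cbox (- (r *\<^sub>R One)) (r *\<^sub>R One)" by (auto simp: mem_box abs_le_iff minus_le_iff)
qed

text \<open>Integrals run over cubes while the geometric hypotheses concern balls; this is the
  source of the dimension factor in the conditions on radii.\<close>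

lemma norm_le_cube:
  assumes "y \<in> cbox (- (r *\<^sub>R One)) (r *\<^sub>R (One :: 'a::euclidean_space))"
  shows "norm y \<le> r * real DIM('a)"
proof -
  have "norm y \<le> (\<Sum>b\<in>Basis. \<bar>inner y b\<bar>)" by (rule norm_le_l1)
  also have "\<dots> \<le> (\<Sum>b\<in>(Basis :: 'a set). r)"
    using assms by (intro sum_mono) (auto simp: mem_box abs_le_iff minus_le_iff)
  finally show ?thesis by (simp add: mult.commute)
qed

lemma integral_rad_pos: "integral (cbox (- One) One) (rad k 1 :: 'a::euclidean_space \<Rightarrow> real) > 0"
proof -
  let ?I = "integral (cbox (- One) One) (rad k 1 :: 'a \<Rightarrow> real)"
  have int: "(rad k 1 :: 'a \<Rightarrow> real) integrable_on cbox (- One) One"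
    by (intro integrable_continuous continuous_rad)
  have nn: "rad k 1 (y :: 'a) \<ge> 0" for y by (simp add: rad_def)
  have "?I \<noteq> 0"
  proof
    assume "?I = 0"
    then have "(rad k 1 has_integral 0) (cbox (- One :: 'a) One)" using int by (metis integrable_integral)
    then have "rad k 1 (0 :: 'a) = 0"
      by (intro has_integral_0_cbox_imp_0[OF continuous_rad]) (auto simp: nn mem_box box_ne_empty)
    then show False by (simp add: rad_def)
  qed
  moreover have "?I \<ge> 0" by (intro integral_nonneg int) (simp add: nn)
  ultimately show ?thesis by simp
qed

text \<open>The variable \<open>x\<close> occurs only in the kernel, so differentiating asks for no
  more than continuity of \<open>f\<close>: smoothness passes from the kernel to the
  convolution.\<close>

lemma has_derivative_integral_kernel:
  fixes f :: "'a::euclidean_space \<Rightarrow> 'b::euclidean_space" and K :: "'a \<Rightarrow> real"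
  assumes K': "\<And>y. (K has_derivative K' y) (at y)"
    and cK': "\<And>v. continuous_on UNIV (\<lambda>y. K' y v)"
    and f: "continuous_on (cbox l r) f"
  shows "((\<lambda>x. integral (cbox l r) (\<lambda>z. K (z - x) *\<^sub>R f z)) has_derivative
      (\<lambda>v. integral (cbox l r) (\<lambda>z. (- K' (z - x) v) *\<^sub>R f z))) (at x)"
proof -
  \<comment> \<open>The derivative in \<open>x\<close> is packaged as a bounded linear map, whose
    joint continuity reduces to that of its values at fixed vectors.\<close>
  define B where "B x z = Blinfun (\<lambda>v. (- K' (z - x) v) *\<^sub>R f z)" for x z
  have cK: "continuous_on UNIV K"
    using K' by (meson continuous_at_imp_continuous_on has_derivative_continuous)
  have bl: "bounded_linear (\<lambda>v. (- K' (z - x) v) *\<^sub>R f z)" for x z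
    using has_derivative_bounded_linear[OF K'[of "z - x"]]
    by (intro bounded_linear_scaleR_const bounded_linear_minus)
  have B: "blinfun_apply (B x z) v = (- K' (z - x) v) *\<^sub>R f z" for x z v
    unfolding B_def by (rule fun_cong[OF bounded_linear_Blinfun_apply[OF bl]])
  have cB: "continuous_on (UNIV \<times> cbox l r) (\<lambda>(x, z). B x z)"
    unfolding case_prod_unfold
    by (intro continuous_on_blinfun_componentwise)
      (auto simp: B intro!: continuous_intros continuous_on_compose2[OF cK'] continuous_on_compose2[OF f])
  have "((\<lambda>x. integral (cbox l r) (\<lambda>z. K (z - x) *\<^sub>R f z)) has_derivative
      blinfun_apply (integral (cbox l r) (B x))) (at x within UNIV)"
  proof (rule leibniz_rule[OF _ _ cB])
    fix x z :: 'a
    have "((\<lambda>x. K (z - x)) has_derivative (\<lambda>v. K' (z - x) (- v))) (at x)"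
      by (rule has_derivative_compose[OF _ K', of "\<lambda>x. z - x" "\<lambda>v. - v"]) (auto intro!: derivative_eq_intros)
    then have "((\<lambda>x. K (z - x) *\<^sub>R f z) has_derivative (\<lambda>v. K' (z - x) (- v) *\<^sub>R f z)) (at x)"
      by (rule has_derivative_scaleR_left)
    moreover have "(\<lambda>v. K' (z - x) (- v) *\<^sub>R f z) = blinfun_apply (B x z)"
      using has_derivative_linear[OF K'[of "z - x"]] by (auto simp: B linear_neg)
    ultimately show "((\<lambda>x. K (z - x) *\<^sub>R f z) has_derivative blinfun_apply (B x z)) (at x within UNIV)"
      by simp
    show "(\<lambda>z. K (z - x) *\<^sub>R f z) integrable_on cbox l r"
      by (intro integrable_continuous continuous_intros f continuous_on_compose2[OF cK]) auto
  qed auto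
  moreover have "blinfun_apply (integral (cbox l r) (B x)) = (\<lambda>v. integral (cbox l r) (\<lambda>z. (- K' (z - x) v) *\<^sub>R f z))"
  proof
    fix v
    have "continuous_on (cbox l r) (B x)"
    proof -
      have "continuous_on (cbox l r) (\<lambda>z. case (x, z) of (x, z) \<Rightarrow> B x z)"
        by (rule continuous_on_compose2[OF cB]) (auto intro!: continuous_intros)
      then show ?thesis by simp
    qed
    then have "B x integrable_on cbox l r" by (rule integrable_continuous)
    then show "blinfun_apply (integral (cbox l r) (B x)) v = integral (cbox l r) (\<lambda>z. (- K' (z - x) v) *\<^sub>R f z)"
      by (simp add: blinfun_apply_integral B)
  qed
  ultimately show ?thesis by simp
qed

lemma continuous_integral_kernel:
  fixes f :: "'a::euclidean_space \<Rightarrow> 'b::euclidean_space" and K :: "'a \<Rightarrow> real"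
  assumes "continuous_on UNIV K" "continuous_on (cbox l r) f"
  shows "continuous_on S (\<lambda>x. integral (cbox l r) (\<lambda>z. K (z - x) *\<^sub>R f z))"
  by (rule integral_continuous_on_param)
    (auto simp: case_prod_unfold intro!: continuous_intros continuous_on_compose2[OF assms(1)]
      continuous_on_compose2[OF assms(2)])

text \<open>\<^term>\<open>rad_div r\<close> is the divergence of $y \mapsto$ \<^term>\<open>rad 3 r y *\<^sub>R y\<close>, and up to the factor
  $-r^{-m-1}$ the derivative in $r$ of \<^term>\<open>rad 3 r y / r ^ m\<close> in dimension $m$.\<close>

definition rad_div :: "real \<Rightarrow> 'a::euclidean_space \<Rightarrow> real" where
  "rad_div r y = real DIM('a) * rad 3 r y - 6 * (inner y y / r\<^sup>2) * rad 2 r y"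

lemma continuous_rad_div: "continuous_on S (rad_div r)"
  unfolding rad_div_def[abs_def] divide_inverse by (intro continuous_intros continuous_rad)

lemma has_derivative_rad_scaled:
  fixes y :: "'a::euclidean_space"
  assumes "s > 0"
  shows "((\<lambda>s. rad 3 s y / s ^ DIM('a)) has_real_derivative - rad_div s y / s ^ (DIM('a) + 1)) (at s)"
proof -
  \<comment> \<open>Writing the dimension as a successor removes the truncated subtraction from the
    derivative of s^DIM.\<close>
  obtain k where k: "DIM('a) = Suc k" using DIM_positive[where 'a='a] gr0_implies_Suc by blast
  let ?c = "inner y y"
  have "((\<lambda>s. 1 - ?c / s\<^sup>2) has_real_derivative 2 * ?c / s ^ 3) (at s)"
    using assms by (auto intro!: derivative_eq_intros simp: field_simps power_numeral_reduce)
  from DERIV_chain2[OF has_real_derivative_max_power[of 1] this]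
  have "((\<lambda>s. rad 3 s y) has_real_derivative 3 * rad 2 s y * (2 * ?c / s ^ 3)) (at s)"
    by (simp add: rad_def numeral_3_eq_3 numeral_2_eq_2)
  then have "((\<lambda>s. rad 3 s y / s ^ DIM('a)) has_real_derivative
     ((3 * rad 2 s y * (2 * ?c / s ^ 3)) * s ^ DIM('a) - rad 3 s y * (real DIM('a) * s ^ (DIM('a) - Suc 0)))
      / (s ^ DIM('a) * s ^ DIM('a))) (at s)"
    using assms by (intro DERIV_divide DERIV_pow) auto
  moreover have "((3 * A * (2 * c / s ^ 3)) * s ^ Suc k - B * (real (Suc k) * s ^ k)) / (s ^ Suc k * s ^ Suc k)
      = - (real (Suc k) * B - 6 * (c / s\<^sup>2) * A) / s ^ (Suc k + 1)" for A B c
    using assms by (simp add: field_simps power_numeral_reduce)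
  ultimately show ?thesis
    unfolding rad_div_def k by (simp only: diff_Suc_Suc diff_zero)
qed

text \<open>The substitution y = s z gives the mean two forms. With \<open>s\<close> inside
  \<open>f\<close> it is continuous down to s = 0, where it is a multiple of \<open>f x\<close>;
  with \<open>s\<close> inside the kernel it can be differentiated for s > 0, and its derivative is
  a multiple of the integral that \<open>div\<close> makes zero.\<close>

lemma mean_value_rad:
  fixes f :: "'a::euclidean_space \<Rightarrow> 'b::euclidean_space" and r \<delta> :: real
  assumes S: "open S" "continuous_on S f" "ball x \<delta> \<subseteq> S"
    and div: "\<And>s. s > 0 \<Longrightarrow> cball x s \<subseteq> S \<Longrightarrow> integral UNIV (\<lambda>y. rad_div s y *\<^sub>R f (x + y)) = 0"
    and r: "r > 0" "r * DIM('a) < \<delta>"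
  shows "integral UNIV (\<lambda>y. rad 3 r y *\<^sub>R f (x + y))
    = (r ^ DIM('a) * integral (cbox (- One) One) (rad 3 1 :: 'a \<Rightarrow> real)) *\<^sub>R f x"
proof -
  define m where "m = real DIM('a)"
  have m: "m \<ge> 1" unfolding m_def using DIM_positive[where 'a='a] by linarith
  \<comment> \<open>The midpoint of r and \<delta> / m makes r interior to the range of scales,
    while the cube of half-width R still keeps x + y inside the ball.\<close>
  define R where "R = (r + \<delta> / m) / 2"
  have R: "r < R" "R * m < \<delta>"
    using r m unfolding R_def m_def[symmetric] by (simp_all add: field_simps)
  then have "R > 0" using r(1) by simp
  note R = R(1) this R(2)
  let ?Q = "\<lambda>s. cbox (- (s *\<^sub>R One)) (s *\<^sub>R One) :: 'a set"
  define J where "J s = integral (?Q 1) (\<lambda>z. rad 3 1 z *\<^sub>R f (x + s *\<^sub>R z))" for s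
  have in_S: "x + s *\<^sub>R z \<in> S" if "0 \<le> s" "s \<le> R" "z \<in> ?Q 1" for s z
  proof -
    have "norm (s *\<^sub>R z) \<le> R * m"
      using that norm_le_cube[OF that(3)] unfolding m_def by (auto intro!: mult_mono)
    then show ?thesis using R S(3) by (auto simp: dist_norm subset_iff)
  qed
  have in_S': "x + y \<in> S" if "y \<in> ?Q R" for y
    using norm_le_cube[OF that] R S(3) by (auto simp: dist_norm subset_iff m_def)
  have ball_S: "cball x s \<subseteq> S" if "s \<le> R" for s
  proof -
    have "R * 1 \<le> R * m" using m R(2) by (intro mult_left_mono) auto
    then have "s < \<delta>" using that R by linarith
    then show ?thesis using S(3) by (auto simp: subset_iff)
  qed
  have out: "rad 3 s y = 0" "rad 2 s y = 0" if "s > 0" "y \<notin> ?Q s" for s and y :: 'a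
  proof -
    have "norm y \<ge> s" using that cball_subset_cube[of s] by (force simp: subset_iff)
    then show "rad 3 s y = 0" "rad 2 s y = 0"
      using rad_outside[OF that(1), of y 2] rad_outside[OF that(1), of y 1]
      by (simp_all add: numeral_3_eq_3 numeral_2_eq_2)
  qed
  have out_norm: "rad 3 s y = 0" if "s > 0" "norm y > s" for s and y :: 'a
    using rad_outside[of s y 2] that by (simp add: numeral_3_eq_3 numeral_2_eq_2)
  have mono: "?Q s \<subseteq> ?Q R" if "s \<le> R" for s
    using that by (auto simp: subset_box)
  have J_eq: "integral UNIV (\<lambda>y. rad 3 s y *\<^sub>R f (x + y)) = s ^ DIM('a) *\<^sub>R J s" if s: "0 < s" "s \<le> R" for s
  proof -
    let ?h = "\<lambda>y. rad 3 s y *\<^sub>R f (x + y)"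
    have "continuous_on UNIV ?h"
      by (rule continuous_on_compact_support_scaleR[OF continuous_rad _ S(1,2) ball_S[OF s(2)]])
        (rule out_norm[OF s(1)])
    then have "?h integrable_on ?Q s"
      by (intro integrable_continuous) (rule continuous_on_subset, auto)
    then have "(?h has_integral integral (?Q s) ?h) (?Q s)" by (rule integrable_integral)
    from has_integral_affinity'[OF this s(1), of 0]
    have "((\<lambda>z. rad 3 s (s *\<^sub>R z) *\<^sub>R f (x + s *\<^sub>R z)) has_integral (integral (?Q s) ?h /\<^sub>R s ^ DIM('a))) (?Q 1)"
      using s(1) by simp
    moreover have "rad 3 s (s *\<^sub>R z) = rad 3 1 z" for z :: 'a
      using s(1) by (simp add: rad_def power2_eq_square)
    ultimately have "J s = integral (?Q s) ?h /\<^sub>R s ^ DIM('a)"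
      unfolding J_def by (auto intro: integral_unique)
    moreover have "integral (?Q s) ?h = integral UNIV ?h"
      by (rule integral_eq_integral_UNIV) (simp add: out[OF s(1)])
    ultimately show ?thesis using s(1) by simp
  qed
  have J_cont: "continuous_on {0..r} J"
    unfolding J_def
    by (rule integral_continuous_on_param)
      (use R in \<open>auto simp: case_prod_unfold intro!: continuous_intros continuous_on_compose2[OF continuous_rad[of UNIV]]
        continuous_on_compose2[OF S(2)] in_S\<close>)
  have J_deriv: "(J has_derivative (\<lambda>h. 0)) (at s within {0..r})" if s: "s \<in> {0..r} - {0}" for s
  proof -
    \<comment> \<open>The same mean in the coordinate y = s z, with the scale confined to the
      kernel.\<close>
    define W where "W s = integral (?Q R) (\<lambda>y. (rad 3 s y / s ^ DIM('a)) *\<^sub>R f (x + y))" for s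
    have s': "0 < s" "s < R" using s R by auto
    have "(W has_vector_derivative integral (?Q R) (\<lambda>y. (- rad_div s y / s ^ (DIM('a) + 1)) *\<^sub>R f (x + y)))
        (at s within {0<..<R})"
      unfolding W_def
    proof (rule leibniz_rule_vector_derivative)
      fix t and y :: 'a assume "t \<in> {0<..<R}"
      then have "((\<lambda>s. rad 3 s y / s ^ DIM('a)) has_real_derivative - rad_div t y / t ^ (DIM('a) + 1))
          (at t within {0<..<R})"
        by (intro has_field_derivative_at_within[OF has_derivative_rad_scaled]) auto
      from has_vector_derivative_scaleR[OF this has_vector_derivative_const]
      show "((\<lambda>s. (rad 3 s y / s ^ DIM('a)) *\<^sub>R f (x + y)) has_vector_derivative
          (- rad_div t y / t ^ (DIM('a) + 1)) *\<^sub>R f (x + y)) (at t within {0<..<R})"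
        by simp
    next
      fix t assume "t \<in> {0<..<R}"
      then show "(\<lambda>y. (rad 3 t y / t ^ DIM('a)) *\<^sub>R f (x + y)) integrable_on ?Q R"
        by (intro integrable_continuous continuous_intros continuous_on_compose2[OF S(2)] continuous_rad)
          (auto simp: in_S')
    next
      show "continuous_on ({0<..<R} \<times> ?Q R) (\<lambda>(s, y). (- rad_div s y / s ^ (DIM('a) + 1)) *\<^sub>R f (x + y))"
        unfolding case_prod_unfold rad_div_def rad_def
        by (intro continuous_intros continuous_on_compose2[OF S(2)]) (auto simp: in_S')
    qed (use s' in auto)
    moreover have "integral (?Q R) (\<lambda>y. (- rad_div s y / s ^ (DIM('a) + 1)) *\<^sub>R f (x + y)) = 0"
    proof -
      have "rad_div s y = 0" if "y \<notin> ?Q R" for y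
      proof -
        have "y \<notin> ?Q s" using that mono[of s] s'(2) by auto
        then show ?thesis by (simp add: rad_div_def out[OF s'(1)])
      qed
      then have "integral (?Q R) (\<lambda>y. rad_div s y *\<^sub>R f (x + y)) = integral UNIV (\<lambda>y. rad_div s y *\<^sub>R f (x + y))"
        by (intro integral_eq_integral_UNIV) simp
      also have "\<dots> = 0" using s' by (intro div ball_S) auto
      finally have "integral (?Q R) (\<lambda>y. rad_div s y *\<^sub>R f (x + y)) = 0" .
      moreover have "(\<lambda>y. (- rad_div s y / s ^ (DIM('a) + 1)) *\<^sub>R f (x + y))
          = (\<lambda>y. (- 1 / s ^ (DIM('a) + 1)) *\<^sub>R (rad_div s y *\<^sub>R f (x + y)))"
        by (auto simp: fun_eq_iff)
      ultimately show ?thesis by (simp only: integral_cmul scaleR_zero_right)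
    qed
    ultimately have W0: "(W has_vector_derivative 0) (at s)"
      using s' by (simp add: at_within_open[of s "{0<..<R}"])
    have WJ: "W t = J t" if t: "t \<in> {0<..<R}" for t
    proof -
      have "W t = integral (?Q R) (\<lambda>y. (1 / t ^ DIM('a)) *\<^sub>R (rad 3 t y *\<^sub>R f (x + y)))"
        unfolding W_def by simp
      also have "\<dots> = (1 / t ^ DIM('a)) *\<^sub>R integral (?Q R) (\<lambda>y. rad 3 t y *\<^sub>R f (x + y))"
        by (rule integral_cmul)
      also have "integral (?Q R) (\<lambda>y. rad 3 t y *\<^sub>R f (x + y)) = integral UNIV (\<lambda>y. rad 3 t y *\<^sub>R f (x + y))"
        using mono[of t] out[of t] t by (intro integral_eq_integral_UNIV) auto
      finally show ?thesis using J_eq[of t] t by simp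
    qed
    have "(J has_vector_derivative 0) (at s)"
      by (rule has_vector_derivative_transform_within_open[OF W0 open_greaterThanLessThan _ WJ])
        (use s' in simp_all)
    then show ?thesis
      by (simp add: has_vector_derivative_def has_derivative_at_withinI)
  qed
  \<comment> \<open>The derivative is known away from 0 only; continuity at 0 permits the
    exceptional set {0}.\<close>
  have "J r = J 0"
    by (rule has_derivative_zero_unique_strong_convex[where K="{0}", OF _ _ J_cont _ refl J_deriv]) (use r in simp_all)
  also have "J 0 = integral (?Q 1) (rad 3 1) *\<^sub>R f x"
    unfolding J_def
    by (rule integral_unique)
      (auto intro!: has_integral_scaleR_left integrable_integral integrable_continuous continuous_rad)
  finally show ?thesis
    using J_eq[of r] r R by simp
qed

section \<open>Regularity of monogenic functions\<close>

lemma bounded_bilinear_clifford_mult: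
  "bounded_bilinear ((*) :: 'n::{finite,linorder} clifford \<Rightarrow> 'n clifford \<Rightarrow> 'n clifford)"
  unfolding bilinear_conv_bounded_bilinear[symmetric] bilinear_def
  by (auto intro!: linearI simp: algebra_simps)

lemmas bounded_linear_clifford_mult_right =
  bounded_bilinear.bounded_linear_right[OF bounded_bilinear_clifford_mult]

lemma Basis_paravector: "(Basis :: 'n::{finite,linorder} paravector set) = insert e_zero (range e_vec)"
  by (auto simp: Basis_prod_def Basis_vec_def e_zero_def e_vec_def image_iff)

lemma sum_Basis_paravector:
  "(\<Sum>b\<in>(Basis :: 'n::{finite,linorder} paravector set). h b) = h e_zero + (\<Sum>i\<in>UNIV. h (e_vec i))"
proof -
  have "inj (e_vec :: 'n \<Rightarrow> _)" by (auto simp: inj_def e_vec_def axis_eq_axis)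
  moreover have "e_zero \<notin> range (e_vec :: 'n \<Rightarrow> _)" by (auto simp: e_zero_def e_vec_def)
  ultimately show ?thesis
    unfolding Basis_paravector by (simp add: sum.reindex)
qed

lemma cauchy_riemann_Basis: "cauchy_riemann f x = (\<Sum>b\<in>Basis. cl_of b * partial b f x)"
  by (simp add: cauchy_riemann_def sum_Basis_paravector)

lemma partial_eq:
  assumes "(f has_derivative f') (at x)"
  shows "partial v f x = f' v"
proof -
  have "((\<lambda>t. f (x + t *\<^sub>R v)) has_derivative (\<lambda>h. f' (h *\<^sub>R v))) (at 0)"
    by (rule has_derivative_compose[of "\<lambda>t. x + t *\<^sub>R v" "\<lambda>h. h *\<^sub>R v"])
      (use assms in \<open>auto intro!: derivative_eq_intros\<close>)
  then have "((\<lambda>t. f (x + t *\<^sub>R v)) has_vector_derivative f' v) (at 0)"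
    by (simp add: has_vector_derivative_def linear_scale[OF has_derivative_linear[OF assms]])
  then show ?thesis unfolding partial_def by (rule vector_derivative_at)
qed

text \<open>Conjugating y makes the divergence of the field collapse to the integrand:
  differentiating conj(y) yields the sum of conj(e_b) e_b, which is the dimension; differentiating
  the kernel yields a multiple of conj(y) y = |y|^2; differentiating \<open>f\<close> yields conj(y)
  Df = 0.\<close>

lemma monogenic_rad_div:
  fixes f :: "'n::{finite,linorder} paravector \<Rightarrow> 'n clifford"
  assumes S: "open S" "left_monogenic_on S f" and r: "r > 0" "cball x r \<subseteq> S"
  shows "integral UNIV (\<lambda>y. rad_div r y *\<^sub>R f (x + y)) = 0"
proof -
  define C :: "'n paravector \<Rightarrow> 'n clifford" where "C y = conjugation (cl_of y)" for y
  have lin_C: "linear C"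
    unfolding C_def using linear_compose[OF linear_cl_of linear_involutions(1)] by (simp add: o_def)
  have df: "(f has_derivative (\<lambda>v. partial v f z)) (at z)" if "z \<in> S" for z
  proof -
    have "f differentiable (at z)" using S(2) that by (auto simp: left_monogenic_on_def)
    then obtain f' where f': "(f has_derivative f') (at z)" by (auto simp: differentiable_def)
    then have "(\<lambda>v. partial v f z) = f'" using partial_eq by blast
    with f' show ?thesis by simp
  qed
  have cr: "(\<Sum>b\<in>Basis. cl_of b * partial b f z) = 0" if "z \<in> S" for z
    using S(2) that by (simp add: left_monogenic_on_def cauchy_riemann_Basis)
  have cf: "continuous_on S f"
    using df by (meson continuous_at_imp_continuous_on has_derivative_continuous)
  have out: "rad 3 r y = 0" "rad 2 r y = 0" if "norm y > r" for y :: "'n paravector"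
    using rad_outside[OF r(1), of y 2] rad_outside[OF r(1), of y 1] that
    by (simp_all add: numeral_3_eq_3 numeral_2_eq_2)
  define F where "F b y = rad 3 r y *\<^sub>R (C y * cl_of b * f (x + y))" for b y
  define R' where "R' y v = (- 6 / r\<^sup>2) * (rad 2 r y * inner y v)" for y v :: "'n paravector"
  \<comment> \<open>Outside \<open>S\<close> nothing is known about \<open>f\<close>, but there |y|
    > r and the field vanishes nearby, so 0 is its derivative.\<close>
  define F' where "F' b y v = (if x + y \<in> S then rad 3 r y *\<^sub>R (C y * cl_of b * partial v f (x + y)
      + C v * cl_of b * f (x + y)) + R' y v *\<^sub>R (C y * cl_of b * f (x + y)) else 0)" for b y v
  have der: "(F b has_derivative F' b y) (at y)" for b y
  proof (cases "x + y \<in> S")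
    case True
    have "bounded_linear (\<lambda>y. C y * cl_of b)"
      unfolding linear_conv_bounded_linear[symmetric]
      by (rule linearI) (simp_all add: linear_add[OF lin_C] linear_scale[OF lin_C] distrib_right)
    then have 1: "((\<lambda>y. C y * cl_of b) has_derivative (\<lambda>v. C v * cl_of b)) (at y)"
      by (rule bounded_linear_imp_has_derivative)
    have 2: "((\<lambda>y. f (x + y)) has_derivative (\<lambda>v. partial v f (x + y))) (at y)"
      by (rule has_derivative_compose[of "\<lambda>y. x + y" "\<lambda>v. v", OF _ df[OF True]])
        (auto intro!: derivative_eq_intros)
    have 3: "(rad 3 r has_derivative R' y) (at y)"
      using has_derivative_rad[of 1 r y] by (simp add: R'_def[abs_def] numeral_3_eq_3 numeral_2_eq_2)
    from has_derivative_scaleR[OF 3 bounded_bilinear.FDERIV[OF bounded_bilinear_clifford_mult 1 2]]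
    show ?thesis unfolding F_def F'_def by (rule has_derivative_eq_rhs) (simp add: True)
  next
    case False
    then have "x + y \<notin> cball x r" using r(2) by blast
    then have "norm y > r" by (simp add: dist_norm)
    have "(F b has_derivative (\<lambda>_. 0)) (at y)"
      by (rule has_derivative_transform_within_open[of "\<lambda>_. 0" _ _ _ "- cball 0 r"])
        (use \<open>norm y > r\<close> in \<open>auto simp: open_Compl F_def out\<close>)
    then show ?thesis using False by (simp add: F'_def[abs_def])
  qed
  have "integral (cbox (- (r *\<^sub>R One)) (r *\<^sub>R One)) (\<lambda>y. rad_div r y *\<^sub>R f (x + y)) = 0"
  proof (rule integral_divergence_0[OF der])
    show "continuous_on UNIV (\<lambda>y. rad_div r y *\<^sub>R f (x + y))"
      by (rule continuous_on_compact_support_scaleR[OF continuous_rad_div _ S(1) cf r(2)])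
        (simp add: rad_div_def out)
    show "rad_div r y *\<^sub>R f (x + y) = (\<Sum>b\<in>Basis. F' b y b)" for y
    proof (cases "x + y \<in> S")
      case True
      have e: "C b * cl_of b = 1" if "b \<in> Basis" for b
        using conjugation_cl_of_mult[of b] that by (simp add: C_def)
      have "(\<Sum>b\<in>Basis. C y * cl_of b * partial b f (x + y)) = 0"
        using cr[OF True] by (simp add: mult.assoc flip: sum_distrib_left)
      moreover have "(\<Sum>b\<in>Basis. C b * cl_of b * f (x + y)) = real DIM('n paravector) *\<^sub>R f (x + y)"
        by (simp add: e sum_constant_scaleR del: sum_constant)
      moreover have "(\<Sum>b\<in>Basis. R' y b *\<^sub>R (C y * cl_of b * f (x + y)))
          = (- 6 * (inner y y / r\<^sup>2) * rad 2 r y) *\<^sub>R f (x + y)"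
      proof -
        \<comment> \<open>The gradient of the kernel is a multiple of y, so the basis sum
          reassembles y next to conj(y).\<close>
        have "(\<Sum>b\<in>Basis. R' y b *\<^sub>R (C y * cl_of b * f (x + y)))
            = ((- 6 / r\<^sup>2) * rad 2 r y) *\<^sub>R (C y * cl_of (\<Sum>b\<in>Basis. inner y b *\<^sub>R b) * f (x + y))"
          by (simp add: R'_def linear_sum[OF linear_cl_of] linear_scale[OF linear_cl_of]
              sum_distrib_left sum_distrib_right scaleR_sum_right mult.assoc)
        also have "C y * cl_of (\<Sum>b\<in>Basis. inner y b *\<^sub>R b) = of_real (inner y y)"
          unfolding euclidean_representation C_def conjugation_cl_of_mult by (simp add: power2_norm_eq_inner)
        finally show ?thesis by (simp add: of_real_def mult_ac)
      qed
      ultimately show ?thesis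
        using True unfolding F'_def rad_div_def
        by (simp add: sum.distrib scaleR_add_right scaleR_diff_left flip: scaleR_sum_right)
    next
      case False
      then have "x + y \<notin> cball x r" using r(2) by blast
      then have "norm y > r" by (simp add: dist_norm)
      then show ?thesis using False by (simp add: F'_def rad_div_def out)
    qed
    have o: "norm y > r" if "y \<notin> cbox (- (r *\<^sub>R One)) (r *\<^sub>R One)" for y :: "'n paravector"
      using that cball_subset_cube[of r] by (force simp: subset_iff)
    show "F b y = 0" if "y \<notin> cbox (- (r *\<^sub>R One)) (r *\<^sub>R One)" for b y
      by (simp add: F_def out[OF o[OF that]])
    show "rad_div r y *\<^sub>R f (x + y) = 0" if "y \<notin> cbox (- (r *\<^sub>R One)) (r *\<^sub>R One)" for y
      by (simp add: rad_div_def out[OF o[OF that]])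
  qed
  moreover have "rad_div r y *\<^sub>R f (x + y) = 0" if "y \<notin> cbox (- (r *\<^sub>R One)) (r *\<^sub>R One)" for y
  proof -
    have "norm y > r" using that cball_subset_cube[of r] by (force simp: subset_iff)
    then show ?thesis by (simp add: rad_div_def out)
  qed
  ultimately show ?thesis by (subst (asm) integral_eq_integral_UNIV) auto
qed

text \<open>Each derivative lowers the lowest exponent of the kernel by one, from 3 to 1, and
  \<open>rad 1\<close> is still continuous. The symmetry of the second derivatives is read off from
  the explicit \<open>K2\<close>.\<close>

lemma integral_kernel_second_derivatives:
  fixes h :: "'a::euclidean_space \<Rightarrow> 'b::euclidean_space" and r :: real
  assumes h: "continuous_on (cbox l u) h"
  defines "U \<equiv> \<lambda>x. integral (cbox l u) (\<lambda>z. rad 3 r (z - x) *\<^sub>R h z)"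
  obtains P Q where "\<And>x. (U has_derivative (\<lambda>v. P v x)) (at x)"
    "\<And>v x. (P v has_derivative (\<lambda>w. Q v w x)) (at x)"
    "\<And>v w. continuous_on UNIV (Q v w)" "\<And>v w x. Q v w x = Q w v x"
proof -
  \<comment> \<open>From the chain rule: -2 times the exponent 3 here, and -2 times the exponent 2
    for the -4 in \<open>K2\<close>.\<close>
  define k where "k = - 6 / r\<^sup>2"
  define K1 where "K1 v y = k * (rad 2 r y * inner y v)" for v y :: 'a
  define K2 where "K2 v w y = k * (rad 2 r y * inner w v + (- 4 / r\<^sup>2) * (rad 1 r y * inner y w) * inner y v)" for v w y :: 'a
  have K1: "(rad 3 r has_derivative (\<lambda>v. K1 v y)) (at y)" for y
    using has_derivative_rad[of 1 r y] by (simp add: K1_def k_def numeral_3_eq_3 numeral_2_eq_2)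
  have K2: "((\<lambda>y. - K1 v y) has_derivative (\<lambda>w. - K2 v w y)) (at y)" for v y
  proof -
    have 1: "(rad 2 r has_derivative (\<lambda>w. (- 4 / r\<^sup>2) * (rad 1 r y * inner y w))) (at y)"
      using has_derivative_rad[of 0 r y] by (simp add: numeral_2_eq_2)
    have 2: "((\<lambda>y. inner y v) has_derivative (\<lambda>w. inner w v)) (at y)"
      by (rule bounded_linear_imp_has_derivative[OF bounded_linear_inner_left])
    from has_derivative_minus[OF has_derivative_mult_right[OF has_derivative_mult[OF 1 2], of k]]
    show ?thesis unfolding K1_def by (rule has_derivative_eq_rhs) (auto simp: K2_def algebra_simps)
  qed
  have c: "continuous_on UNIV (K1 v)" "continuous_on UNIV (K2 v w)" for v w
    unfolding K1_def[abs_def] K2_def[abs_def] by (intro continuous_intros continuous_rad)+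
  show ?thesis
  proof (rule that)
    show "(U has_derivative (\<lambda>v. integral (cbox l u) (\<lambda>z. (- K1 v (z - x)) *\<^sub>R h z))) (at x)" for x
      unfolding U_def by (rule has_derivative_integral_kernel[OF K1 _ h]) (rule c)
    show "((\<lambda>x. integral (cbox l u) (\<lambda>z. (- K1 v (z - x)) *\<^sub>R h z)) has_derivative
        (\<lambda>w. integral (cbox l u) (\<lambda>z. (- (- K2 v w (z - x))) *\<^sub>R h z))) (at x)" for v x
      by (rule has_derivative_integral_kernel[OF K2 _ h]) (intro continuous_on_minus c)
    show "continuous_on UNIV (\<lambda>x. integral (cbox l u) (\<lambda>z. (- (- K2 v w (z - x))) *\<^sub>R h z))" for v w
      by (rule continuous_integral_kernel[OF _ h]) (intro continuous_on_minus c)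
    show "integral (cbox l u) (\<lambda>z. (- (- K2 v w (z - x))) *\<^sub>R h z)
        = integral (cbox l u) (\<lambda>z. (- (- K2 w v (z - x))) *\<^sub>R h z)" for v w x
      by (simp add: K2_def inner_commute mult_ac)
  qed
qed

text \<open>The mean value identity at \<open>x\<close>, divided by the mass of the kernel, is a
  convolution. A single cube around \<open>x0\<close> contains the support of the kernel for every
  nearby \<open>x\<close>, so neither the domain nor \<open>h\<close> depends on
  \<open>x\<close>.\<close>

lemma monogenic_kernel_representation:
  fixes f :: "'n::{finite,linorder} paravector \<Rightarrow> 'n clifford"
  assumes S: "open S" "left_monogenic_on S f" and x0: "x0 \<in> S"
  obtains l u r h where "r > 0" "continuous_on (cbox l u) h"
    "\<And>x. x \<in> ball x0 r \<Longrightarrow> x \<in> S \<and> f x = integral (cbox l u) (\<lambda>z. rad 3 r (z - x) *\<^sub>R h z)"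
proof -
  obtain m where m: "m = real DIM('n paravector)" by blast
  have "m \<ge> 1" unfolding m using DIM_positive[where 'a="'n paravector"] by linarith
  obtain \<delta> where \<delta>: "\<delta> > 0" "ball x0 \<delta> \<subseteq> S" using S(1) x0 openE by blast
  \<comment> \<open>Both r m and r stay below \<delta> / 4: the cube of half-width 2r around
    \<open>x0\<close> then lies in \<open>ball x0 \<delta>\<close>, and so does the ball of radius
    \<delta> / 2 around any x in \<open>ball x0 r\<close>.\<close>
  define r where "r = \<delta> / (4 * (m + 1))"
  have r: "r > 0" "r * m < \<delta> / 4" "r < \<delta> / 4"
    using \<delta>(1) \<open>m \<ge> 1\<close> by (simp_all add: r_def field_simps)
  let ?B = "cbox (x0 - (2 * r) *\<^sub>R One) (x0 + (2 * r) *\<^sub>R One)"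
  define I where "I = r ^ DIM('n paravector) * integral (cbox (- One) One) (rad 3 1 ::  'n paravector \<Rightarrow> real)"
  have I: "I \<noteq> 0" unfolding I_def using r(1) integral_rad_pos[where 'a="'n paravector", of 3] by (simp del: DIM_prod)
  have cf: "continuous_on S f"
    using S(2) by (meson continuous_at_imp_continuous_on differentiable_imp_continuous_within left_monogenic_on_def)
  have B_S: "?B \<subseteq> S"
  proof
    fix z assume "z \<in> ?B"
    then have "z - x0 \<in> cbox (- ((2 * r) *\<^sub>R One)) ((2 * r) *\<^sub>R One)"
      by (simp add: mem_box inner_diff_left inner_add_left algebra_simps)
    from norm_le_cube[OF this] have "norm (z - x0) \<le> 2 * (r * m)" unfolding m by (simp only: mult.assoc)
    then have "z \<in> ball x0 \<delta>" using r \<delta>(1) by (simp add: dist_norm norm_minus_commute)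
    then show "z \<in> S" using \<delta>(2) by blast
  qed
  show ?thesis
  proof (rule that[OF r(1)])
    show "continuous_on ?B (\<lambda>z. (1 / I) *\<^sub>R f z)"
      by (intro continuous_intros continuous_on_subset[OF cf B_S])
    fix x assume x: "x \<in> ball x0 r"
    have sub: "ball x (\<delta> / 2) \<subseteq> S"
    proof
      fix y assume "y \<in> ball x (\<delta> / 2)"
      then have "dist x0 y < \<delta>" using x r(3) \<delta>(1) dist_triangle[of x0 y x] by (simp add: dist_commute)
      then show "y \<in> S" using \<delta>(2) by auto
    qed
    let ?k = "\<lambda>z. rad 3 r (z - x) *\<^sub>R f z"
    let ?Bx = "cbox (x - r *\<^sub>R One) (x + r *\<^sub>R One)"
    have out: "rad 3 r y = 0" if "y \<notin> cbox (- (r *\<^sub>R One)) (r *\<^sub>R One)" for y :: "'n paravector"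
    proof -
      have "norm y \<ge> r" using that cball_subset_cube[of r] by (force simp: subset_iff)
      then show ?thesis using rad_outside[OF r(1), of y 2] by (simp add: numeral_3_eq_3 numeral_2_eq_2)
    qed
    have zero: "?k z = 0" if "z \<notin> ?Bx" for z
    proof -
      have "z - x \<notin> cbox (- (r *\<^sub>R One)) (r *\<^sub>R One)"
        using that by (auto simp: mem_box inner_diff_left inner_add_left algebra_simps)
      from out[OF this] show ?thesis by simp
    qed
    have Bx: "?Bx \<subseteq> ?B"
    proof
      fix z assume z: "z \<in> ?Bx"
      have "\<bar>inner (x - x0) b\<bar> \<le> r" if "b \<in> Basis" for b
        using Basis_le_norm[OF that, of "x - x0"] x by (simp add: dist_norm norm_minus_commute)
      then show "z \<in> ?B" using z
        by (force simp: mem_box inner_diff_left inner_add_left abs_le_iff simp del: split_paired_All)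
    qed
    have "I *\<^sub>R f x = integral UNIV (\<lambda>y. rad 3 r y *\<^sub>R f (x + y))"
      unfolding I_def
    proof (rule mean_value_rad[OF S(1) cf sub _ r(1), symmetric])
      show "r * real DIM('n paravector) < \<delta> / 2" using r m \<delta>(1) by simp
      show "integral UNIV (\<lambda>y. rad_div s y *\<^sub>R f (y' + y)) = 0" if "s > 0" "cball y' s \<subseteq> S" for s y'
        by (rule monogenic_rad_div[OF S that])
    qed
    also have "\<dots> = integral (cbox (- (r *\<^sub>R One)) (r *\<^sub>R One)) (\<lambda>y. rad 3 r y *\<^sub>R f (x + y))"
      by (rule integral_eq_integral_UNIV[symmetric]) (subst out, assumption, simp)
    also have "\<dots> = integral ?Bx ?k"
      using integral_shift_cbox[of "x - r *\<^sub>R One" x "x + r *\<^sub>R One" ?k] by (simp add: add.commute)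
    also have "\<dots> = integral UNIV ?k"
      by (rule integral_eq_integral_UNIV[OF zero])
    also have "\<dots> = integral ?B ?k"
      using Bx zero by (intro integral_eq_integral_UNIV[symmetric]) blast
    finally have "f x = (1 / I) *\<^sub>R integral ?B ?k"
      using I by (metis (no_types) scaleR_one scaleR_scaleR nonzero_eq_divide_eq)
    also have "\<dots> = integral ?B (\<lambda>z. (1 / I) *\<^sub>R ?k z)" by (rule integral_cmul[symmetric])
    also have "(\<lambda>z. (1 / I) *\<^sub>R ?k z) = (\<lambda>z. rad 3 r (z - x) *\<^sub>R ((1 / I) *\<^sub>R f z))"
      by (rule ext) simp
    finally have "f x = integral ?B (\<lambda>z. rad 3 r (z - x) *\<^sub>R ((1 / I) *\<^sub>R f z))" .
    moreover have "x \<in> S" using sub \<delta>(1) by auto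
    ultimately show "x \<in> S \<and> f x = integral ?B (\<lambda>z. rad 3 r (z - x) *\<^sub>R ((1 / I) *\<^sub>R f z))" by blast
  qed
qed

text \<open>Near \<open>x\<close> the function coincides with a kernel integral, and derivatives
  depend on nearby values only, so all four facts are inherited from that integral.\<close>

lemma monogenic_second_derivatives:
  fixes f :: "'n::{finite,linorder} paravector \<Rightarrow> 'n clifford"
  assumes S: "open S" "left_monogenic_on S f" and x: "x \<in> S"
  shows "(f has_derivative (\<lambda>v. partial v f x)) (at x)"
    and "(partial v f has_derivative (\<lambda>w. partial w (partial v f) x)) (at x)"
    and "isCont (partial w (partial v f)) x"
    and "partial w (partial v f) x = partial v (partial w f) x"
proof -
  obtain l u r h where r: "r > 0" and h: "continuous_on (cbox l u) h"
    and rep: "\<And>y. y \<in> ball x r \<Longrightarrow> y \<in> S \<and> f y = integral (cbox l u) (\<lambda>z. rad 3 r (z - y) *\<^sub>R h z)"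
    by (rule monogenic_kernel_representation[OF S x]) (rule that)
  obtain P Q where P: "\<And>x. ((\<lambda>y. integral (cbox l u) (\<lambda>z. rad 3 r (z - y) *\<^sub>R h z)) has_derivative (\<lambda>v. P v x)) (at x)"
    and Q: "\<And>v x. (P v has_derivative (\<lambda>w. Q v w x)) (at x)"
    and cQ: "\<And>v w. continuous_on UNIV (Q v w)" and sym: "\<And>v w x. Q v w x = Q w v x"
    by (rule integral_kernel_second_derivatives[OF h]) (rule that)
  have f': "(f has_derivative (\<lambda>v. P v y)) (at y)" if "y \<in> ball x r" for y
    by (rule has_derivative_transform_within_open[OF P open_ball that]) (simp add: rep)
  have p1: "partial v f y = P v y" if "y \<in> ball x r" for v y
    by (rule partial_eq[OF f'[OF that]])
  have f'': "(partial v f has_derivative (\<lambda>w. Q v w y)) (at y)" if "y \<in> ball x r" for v y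
    by (rule has_derivative_transform_within_open[OF Q open_ball that]) (simp add: p1)
  have p2: "partial w (partial v f) y = Q v w y" if "y \<in> ball x r" for v w y
    by (rule partial_eq[OF f''[OF that]])
  have x': "x \<in> ball x r" using r by simp
  show "(f has_derivative (\<lambda>v. partial v f x)) (at x)"
    using f'[OF x'] by (simp add: p1[OF x'])
  show "(partial v f has_derivative (\<lambda>w. partial w (partial v f) x)) (at x)"
    using f''[OF x'] by (simp add: p2[OF x'])
  show "partial w (partial v f) x = partial v (partial w f) x"
    by (simp add: p2[OF x'] sym)
  have "continuous_on (ball x r) (partial w (partial v f))"
    by (rule continuous_on_eq[of _ "Q v w"]) (use continuous_on_subset[OF cQ] p2 in auto)
  then show "isCont (partial w (partial v f)) x"
    using x' by (simp add: continuous_on_eq_continuous_at)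
qed

text \<open>The Laplacian is the conjugate Cauchy-Riemann operator times the Cauchy-Riemann operator.\<close>

lemma monogenic_harmonic:
  fixes f :: "'n::{finite,linorder} paravector \<Rightarrow> 'n clifford"
  assumes S: "open S" "left_monogenic_on S f" and x: "x \<in> S"
  shows "(\<Sum>b\<in>Basis. partial b (partial b f) x) = 0"
proof -
  note d2 = monogenic_second_derivatives(2,4)[OF S x]
  define H where "H c b = partial c (partial b f) x" for c b
  define C :: "'n paravector \<Rightarrow> 'n clifford" where "C b = conjugation (cl_of b)" for b
  have "(\<Sum>b\<in>Basis. cl_of b * H c b) = 0" for c
  proof -
    have "((\<lambda>y. \<Sum>b\<in>Basis. cl_of b * partial b f y) has_derivative
        (\<lambda>w. \<Sum>b\<in>Basis. cl_of b * partial w (partial b f) x)) (at x)"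
      by (intro has_derivative_sum bounded_linear.has_derivative[OF bounded_linear_clifford_mult_right] d2)
    moreover have "((\<lambda>y. \<Sum>b\<in>Basis. cl_of b * partial b f y) has_derivative (\<lambda>_. 0)) (at x)"
      by (rule has_derivative_transform_within_open[OF has_derivative_const S(1) x, of 0])
        (use S(2) in \<open>simp add: left_monogenic_on_def cauchy_riemann_Basis\<close>)
    ultimately have "(\<lambda>w. \<Sum>b\<in>Basis. cl_of b * partial w (partial b f) x) = (\<lambda>_. 0)"
      by (rule has_derivative_unique)
    then show ?thesis unfolding H_def by (rule fun_cong)
  qed
  then have "(\<Sum>c\<in>Basis. C c * (\<Sum>b\<in>Basis. cl_of b * H c b)) = 0" by simp
  then have 1: "(\<Sum>c\<in>Basis. \<Sum>b\<in>Basis. C c * cl_of b * H c b) = 0"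
    by (simp add: sum_distrib_left mult.assoc)
  \<comment> \<open>Exchanging the indices and using the symmetry of second derivatives lets the
    coefficient be averaged to conj(e_c) e_b + conj(e_b) e_c, twice the Kronecker delta.\<close>
  then have "(\<Sum>c\<in>Basis. \<Sum>b\<in>Basis. C b * cl_of c * H b c) = 0"
    by (subst sum.swap)
  then have 2: "(\<Sum>c\<in>Basis. \<Sum>b\<in>Basis. C b * cl_of c * H c b) = 0"
    using d2(2) by (simp add: H_def)
  have "(\<Sum>c\<in>Basis. \<Sum>b\<in>Basis. (C c * cl_of b + C b * cl_of c) * H c b) = 0"
    using 1 2 by (simp add: distrib_right sum.distrib)
  moreover have "(C c * cl_of b + C b * cl_of c) * H c b = (if c = b then 2 *\<^sub>R H b b else 0)"
    if "c \<in> Basis" "b \<in> Basis" for c b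
    using that cl_of_polar[of c b] by (simp add: C_def inner_Basis of_real_def)
  ultimately have "(\<Sum>c\<in>Basis. 2 *\<^sub>R H c c) = 0" by simp
  then show ?thesis by (simp add: H_def flip: scaleR_sum_right)
qed

section \<open>Multiplication by powers of the last coordinate\<close>

lemma open_upper_half_space: "open (upper_half_space :: 'n::{finite,linorder} paravector set)"
proof -
  have "continuous_on UNIV (last_coord :: 'n paravector \<Rightarrow> real)"
    unfolding last_coord_def[abs_def] by (intro continuous_intros)
  then show ?thesis
    unfolding upper_half_space_def
    by (intro open_Collect_less continuous_on_const)
qed

lemma has_derivative_last_coord: "(last_coord has_derivative last_coord) F"
proof (rule bounded_linear_imp_has_derivative)
  show "bounded_linear (last_coord :: 'a paravector \<Rightarrow> real)"
    unfolding linear_conv_bounded_linear[symmetric] by (rule linearI) simp_all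
qed

lemma has_derivative_last_coord_powr:
  assumes "x \<in> upper_half_space" "(f has_derivative f') (at x)"
  shows "((\<lambda>x. (last_coord x powr s) *\<^sub>R f x) has_derivative
    (\<lambda>v. (last_coord x powr s) *\<^sub>R f' v + (s * last_coord v * last_coord x powr (s - 1)) *\<^sub>R f x)) (at x)"
proof -
  have "last_coord x > 0" using assms(1) by (simp add: upper_half_space_def)
  then have "((\<lambda>t. t powr s) has_real_derivative s * last_coord x powr (s - 1)) (at (last_coord x))"
    by (rule has_real_derivative_powr)
  from has_derivative_compose[OF has_derivative_last_coord this[unfolded has_field_derivative_def]]
  have "((\<lambda>x. last_coord x powr s) has_derivative (\<lambda>v. s * last_coord x powr (s - 1) * last_coord v)) (at x)" .
  from has_derivative_scaleR[OF this assms(2)] show ?thesis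
    by (rule has_derivative_eq_rhs) (simp add: mult_ac)
qed

lemma continuous_on_last_coord_powr:
  "continuous_on upper_half_space (\<lambda>x. last_coord x powr s)"
  by (intro continuous_intros continuous_at_imp_continuous_on ballI has_derivative_continuous[OF has_derivative_last_coord])
    (auto simp: upper_half_space_def)

context
  fixes f g :: "'n::{finite,linorder} paravector \<Rightarrow> 'n clifford" and s :: real
  assumes f: "left_monogenic_on upper_half_space f"
    and g: "\<And>x. x \<in> upper_half_space \<Longrightarrow> g x = (last_coord x powr s) *\<^sub>R f x"
begin

lemmas monogenic_derivs = monogenic_second_derivatives[OF open_upper_half_space f]

lemma weighted_has_derivative:
  assumes x: "x \<in> upper_half_space"
  shows "(g has_derivative (\<lambda>v. (last_coord x powr s) *\<^sub>R partial v f x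
      + (s * last_coord v * last_coord x powr (s - 1)) *\<^sub>R f x)) (at x)"
  by (rule has_derivative_transform_within_open[OF
      has_derivative_last_coord_powr[OF x monogenic_derivs(1)[OF x]] open_upper_half_space x]) (simp add: g)

lemma weighted_partial:
  "x \<in> upper_half_space \<Longrightarrow> partial v g x = (last_coord x powr s) *\<^sub>R partial v f x
      + (s * last_coord v * last_coord x powr (s - 1)) *\<^sub>R f x"
  by (rule partial_eq[OF weighted_has_derivative])

lemma weighted_has_second_derivative:
  assumes x: "x \<in> upper_half_space"
  shows "(partial v g has_derivative (\<lambda>w. (last_coord x powr s) *\<^sub>R partial w (partial v f) x
      + (s * last_coord w * last_coord x powr (s - 1)) *\<^sub>R partial v f x
      + (s * last_coord v) *\<^sub>R ((last_coord x powr (s - 1)) *\<^sub>R partial w f x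
        + ((s - 1) * last_coord w * last_coord x powr (s - 1 - 1)) *\<^sub>R f x))) (at x)"
proof (rule has_derivative_transform_within_open[OF _ open_upper_half_space x])
  show "((\<lambda>x. (last_coord x powr s) *\<^sub>R partial v f x
      + (s * last_coord v) *\<^sub>R ((last_coord x powr (s - 1)) *\<^sub>R f x)) has_derivative
      (\<lambda>w. (last_coord x powr s) *\<^sub>R partial w (partial v f) x
      + (s * last_coord w * last_coord x powr (s - 1)) *\<^sub>R partial v f x
      + (s * last_coord v) *\<^sub>R ((last_coord x powr (s - 1)) *\<^sub>R partial w f x
        + ((s - 1) * last_coord w * last_coord x powr (s - 1 - 1)) *\<^sub>R f x))) (at x)"
    by (intro has_derivative_add has_derivative_scaleR_right has_derivative_last_coord_powr[OF x] monogenic_derivs x)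
qed (simp add: weighted_partial)

lemma weighted_second_partial:
  "x \<in> upper_half_space \<Longrightarrow> partial w (partial v g) x = (last_coord x powr s) *\<^sub>R partial w (partial v f) x
      + (s * last_coord w * last_coord x powr (s - 1)) *\<^sub>R partial v f x
      + (s * last_coord v) *\<^sub>R ((last_coord x powr (s - 1)) *\<^sub>R partial w f x
        + ((s - 1) * last_coord w * last_coord x powr (s - 1 - 1)) *\<^sub>R f x)"
  by (rule partial_eq[OF weighted_has_second_derivative])

lemma C2_on_weighted: "C2_on upper_half_space g"
  unfolding C2_on_def
proof (intro conjI ballI allI)
  show "g differentiable (at x)" if "x \<in> upper_half_space" for x
    using weighted_has_derivative[OF that] unfolding differentiable_def by blast
  show "partial v g differentiable (at x)" if "x \<in> upper_half_space" for x v
    using weighted_has_second_derivative[OF that] unfolding differentiable_def by blast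
  have c: "continuous_on upper_half_space f" "continuous_on upper_half_space (partial v f)"
    "continuous_on upper_half_space (partial w (partial v f))" for v w
    using monogenic_derivs(1-3) by (meson continuous_at_imp_continuous_on has_derivative_continuous)+
  show "continuous_on upper_half_space (partial w (partial v g))" for w v
    by (rule continuous_on_eq[OF _ weighted_second_partial[symmetric]])
      (intro continuous_on_add continuous_on_scaleR continuous_on_mult continuous_on_const
        continuous_on_last_coord_powr c)
qed

text \<open>Write t = x_n. As \<open>f\<close> is harmonic, t^2 times the Laplacian of t^s f is 2s
  t^(s+1) D + s(s-1) t^s f, with D the derivative of \<open>f\<close> in the last direction. The
  drift term subtracts 2s t^(s+1) D + 2s^2 t^s f because n - 1 = 2s. What is left is -s(s+1) t^s f,
  and s(s+1) = (n^2-1)/4.\<close>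

lemma laplace_beltrami_weighted:
  assumes s: "2 * s = real CARD('n) - 1" and x: "x \<in> upper_half_space"
  shows "laplace_beltrami g x = (- (1 / 4) * ((real CARD('n))\<^sup>2 - 1)) *\<^sub>R g x"
proof -
  define t where "t = last_coord x"
  define D where "D = partial (e_vec (Max UNIV)) f x"
  have t: "t > 0" using x by (simp add: t_def upper_half_space_def)
  have last: "last_coord (e_zero :: 'n paravector) = 0"
    "last_coord (e_vec i :: 'n paravector) = (if i = Max UNIV then 1 else 0)" for i
    by (auto simp: last_coord_def e_zero_def e_vec_def axis_def)
  define h where "h b = (2 * (s * last_coord b * t powr (s - 1))) *\<^sub>R partial b f x
        + (s * (s - 1) * (last_coord b * last_coord b) * t powr (s - 1 - 1)) *\<^sub>R f x" for b
  have h: "h e_zero = 0" "h (e_vec i) = (if i = Max UNIV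
      then (2 * (s * t powr (s - 1))) *\<^sub>R D + (s * (s - 1) * t powr (s - 1 - 1)) *\<^sub>R f x else 0)" for i
    by (simp_all add: h_def last D_def)
  \<comment> \<open>The two cross terms of the product rule coincide, since both derivatives are
    taken in the same direction.\<close>
  have collect: "p *\<^sub>R A + (s * l * T) *\<^sub>R B + (s * l) *\<^sub>R (T *\<^sub>R B + (k * l * q) *\<^sub>R C)
      = p *\<^sub>R A + ((2 * (s * l * T)) *\<^sub>R B + (s * k * (l * l) * q) *\<^sub>R C)"
    for A B C :: "'n clifford" and p T l k q :: real
  proof -
    have "(2 * (s * l * T)) *\<^sub>R B = (s * l * T) *\<^sub>R B + (s * l * T) *\<^sub>R B"
      by (simp only: mult_2 scaleR_add_left)
    then show ?thesis by (simp add: scaleR_add_right mult_ac)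
  qed
  have "partial b (partial b g) x = (t powr s) *\<^sub>R partial b (partial b f) x
      + h b" for b
    unfolding h_def weighted_second_partial[OF x] t_def[symmetric] by (rule collect)
  then have "(\<Sum>b\<in>Basis. partial b (partial b g) x) =
      (t powr s) *\<^sub>R (\<Sum>b\<in>Basis. partial b (partial b f) x)
      + (\<Sum>b\<in>Basis. h b)"
    by (simp only: sum.distrib scaleR_sum_right)
  also have "(\<Sum>b\<in>(Basis :: 'n paravector set). h b)
      = (\<Sum>i\<in>(UNIV :: 'n set). if i = Max UNIV then (2 * (s * t powr (s - 1))) *\<^sub>R D + (s * (s - 1) * t powr (s - 1 - 1)) *\<^sub>R f x else 0)"
    by (simp only: sum_Basis_paravector h add_0_left)
  finally have "partial e_zero (partial e_zero g) x + (\<Sum>i\<in>UNIV. partial (e_vec i) (partial (e_vec i) g) x)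
      = (2 * (s * t powr (s - 1))) *\<^sub>R D + (s * (s - 1) * t powr (s - 1 - 1)) *\<^sub>R f x"
    by (simp add: monogenic_harmonic[OF open_upper_half_space f x] flip: sum_Basis_paravector[of "\<lambda>b. partial b (partial b g) x"])
  moreover have "partial (e_vec (Max UNIV)) g x = (t powr s) *\<^sub>R D + (s * t powr (s - 1)) *\<^sub>R f x"
    by (simp add: weighted_partial[OF x] last D_def t_def)
  ultimately have "laplace_beltrami g x = t\<^sup>2 *\<^sub>R ((2 * (s * t powr (s - 1))) *\<^sub>R D + (s * (s - 1) * t powr (s - 1 - 1)) *\<^sub>R f x)
      - (2 * s * t) *\<^sub>R ((t powr s) *\<^sub>R D + (s * t powr (s - 1)) *\<^sub>R f x)"
    by (simp only: laplace_beltrami_def t_def[symmetric] s)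
  also have "\<dots> = (t\<^sup>2 * (2 * (s * t powr (s - 1))) - 2 * s * t * (t powr s)) *\<^sub>R D
      + (t\<^sup>2 * (s * (s - 1) * t powr (s - 1 - 1)) - 2 * s * t * (s * t powr (s - 1))) *\<^sub>R f x"
    by (simp add: scaleR_add_right scaleR_diff_left)
  also have "\<dots> = 0 *\<^sub>R D + (- (s * (s + 1)) * t powr s) *\<^sub>R f x"
  proof -
    have pw: "t powr (s - 1) = t powr s / t" "t powr (s - 1 - 1) = t powr s / t\<^sup>2"
      using t by (simp_all add: powr_diff power2_eq_square)
    have "t\<^sup>2 * (2 * (s * t powr (s - 1))) - 2 * s * t * (t powr s) = 0"
      "t\<^sup>2 * (s * (s - 1) * t powr (s - 1 - 1)) - 2 * s * t * (s * t powr (s - 1)) = - (s * (s + 1)) * t powr s"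
      unfolding pw using t by (simp_all add: field_simps power2_eq_square)
    then show ?thesis by (simp only:)
  qed
  also have "s * (s + 1) = (1 / 4) * ((real CARD('n))\<^sup>2 - 1)"
  proof -
    have "real CARD('n) = 2 * s + 1" using s by simp
    then show ?thesis by (simp add: power2_eq_square algebra_simps)
  qed
  finally show ?thesis by (simp add: g[OF x] t_def)
qed

end

theorem theorem1:
  fixes p N :: nat
    and I :: "'n::{finite,linorder} clifford set"
    and f g :: "'n paravector \<Rightarrow> 'n clifford"
  assumes "p \<le> CARD('n) - 1" and "N \<ge> 1"
    and "is_Z_order I"
    and "\<forall>y\<in>I. reversion y \<in> I" and "\<forall>y\<in>I. main_involution y \<in> I"
    and "left_monogenic_on upper_half_space f"
    and "automorphic_on (Gamma_cong p I N)
           (\<lambda>M x. conjugation (cocycle M x) /\<^sub>R norm (cocycle M x) ^ (CARD('n) + 1)) f"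
    and "\<forall>x\<in>upper_half_space. g x = (last_coord x powr (- (1 - real CARD('n)) / 2)) *\<^sub>R f x"
  shows "C2_on upper_half_space g \<and>
    (\<forall>x\<in>upper_half_space.
       laplace_beltrami g x = (- (1 / 4) * ((real CARD('n))\<^sup>2 - 1)) *\<^sub>R g x) \<and>
    automorphic_on (Gamma_cong p I N)
      (\<lambda>M x. conjugation (cocycle M x) /\<^sub>R (norm (cocycle M x))\<^sup>2) g"
proof (intro conjI ballI)
  define s where "s = - (1 - real CARD('n)) / 2"
  have g: "g x = (last_coord x powr s) *\<^sub>R f x" if "x \<in> upper_half_space" for x
    using assms(8) that by (simp add: s_def)
  show "C2_on upper_half_space g" by (rule C2_on_weighted[OF assms(6) g])
  show "laplace_beltrami g x = (- (1 / 4) * ((real CARD('n))\<^sup>2 - 1)) *\<^sub>R g x"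
    if "x \<in> upper_half_space" for x
    by (rule laplace_beltrami_weighted[OF assms(6) g _ that]) (simp_all add: s_def)
  show "automorphic_on (Gamma_cong p I N) (\<lambda>M x. conjugation (cocycle M x) /\<^sub>R (norm (cocycle M x))\<^sup>2) g"
    unfolding automorphic_on_def
  proof (intro ballI)
    fix x :: "'n paravector" and M
    assume x: "x \<in> upper_half_space" and M: "M \<in> Gamma_cong p I N"
    have "M \<in> SAV p" using M by (auto simp: Gamma_cong_def Gamma_def SAV_rat_def)
    note mo = moebius_upper_half_space[OF assms(1) this x]
    define q where "q = norm (cocycle M x)"
    define t where "t = last_coord x"
    have q: "q > 0" using mo(1) by (simp add: q_def)
    have t: "t > 0" using x by (simp add: t_def upper_half_space_def)
    \<comment> \<open>The image point must lie in the half-space before \<open>g\<close> there can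
      be expressed through \<open>f\<close>.\<close>
    have mo_x: "moebius M x \<in> upper_half_space"
      using mo(2) q t by (simp add: upper_half_space_def q_def t_def)
    \<comment> \<open>Since n >= 1, the natural-number difference n - 1 agrees with the real
      one.\<close>
    have "q powr (real CARD('n) - 1) = q ^ (CARD('n) - 1)"
      using q powr_realpow[of q "CARD('n) - 1"] by (simp add: of_nat_diff Suc_leI)
    moreover have "(q\<^sup>2) powr s = q powr (2 * s)"
      using q by (simp add: powr_powr flip: powr_numeral)
    moreover have "2 * s = real CARD('n) - 1" by (simp add: s_def)
    ultimately have q_s: "(q\<^sup>2) powr s = q ^ (CARD('n) - 1)" by simp
    \<comment> \<open>Two of the n + 1 powers remain as the new automorphy factor; the other n - 1
      form (q^2)^s, the ratio of the weights x_n^s at x and at its image.\<close>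
    have "CARD('n) + 1 = 2 + (CARD('n) - 1)" using zero_less_card_finite[where 'a='n] by linarith
    then have q_n: "q ^ (CARD('n) + 1) = q\<^sup>2 * (q\<^sup>2) powr s" by (simp only: power_add q_s)
    have "f x = conjugation (cocycle M x) /\<^sub>R (q ^ (CARD('n) + 1)) * f (moebius M x)"
      using assms(7) x M by (simp only: automorphic_on_def q_def)
    then have "g x = (t powr s / q ^ (CARD('n) + 1)) *\<^sub>R (conjugation (cocycle M x) * f (moebius M x))"
      by (simp add: g[OF x] t_def divide_inverse)
    also have "t powr s / q ^ (CARD('n) + 1) = (1 / q\<^sup>2) * (t / q\<^sup>2) powr s"
      unfolding q_n using t q by (simp add: powr_divide)
    also have "((1 / q\<^sup>2) * (t / q\<^sup>2) powr s) *\<^sub>R (conjugation (cocycle M x) * f (moebius M x))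
        = conjugation (cocycle M x) /\<^sub>R q\<^sup>2 * g (moebius M x)"
      by (simp add: g[OF mo_x] mo(2) t_def q_def divide_inverse)
    finally show "g x = conjugation (cocycle M x) /\<^sub>R (norm (cocycle M x))\<^sup>2 * g (moebius M x)"
      by (simp only: q_def)
  qed
qed

end
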